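(* Let $V:\mathbb{R}^3\to\mathbb{R}^3$ be the 1-1-1 ABC flow, $V(x,y,z)=(\sin z+\cos y,\ \sin x+\cos z,\ \sin y+\cos x)$, and let $s_l>0$ be a constant. For $K\ge 0$ and a unit vector $p\in\mathbb{R}^3$, let $s_T(p,K)$ be the turbulent flame speed in direction $p$ given by the G-equation $G_t+KV(x)\cdot\nabla G+s_l|\nabla G|=0$. Then for any unit vector $p\in\mathbb{R}^3$, $$\lim_{K\to\infty}\frac{s_T(p,K)}{K}>0.$$
   Context: The G-equation is the level set Hamilton-Jacobi equation $G_t+KV(x)\cdot\nabla G+s_l|\nabla G|=0$ on $\mathbb{R}^3\times(0,\infty)$, where $K\ge0$ is the flow amplitude and the constant $s_l>0$ is the laminar flame speed; here $V$ is smooth, periodic and divergence free. The turbulent flame speed $s_T(p,K)$ in the unit direction $p$ is the large-time front speed $$s_T(p,K)=\lim_{t\to\infty}\frac{-G(x,t)}{t},$$ where $G$ is the unique viscosity solution of the G-equation with initial datum $G(x,0)=p\cdot x$. (The limit exists and is independent of $x\in\mathbb{R}^3$; equivalently, $s_T(p,K)$ is the effective Hamiltonian at $p$ of the Hamiltonian $H(q,x)=s_l|q|+KV(x)\cdot q$.) *)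

theory Defs
  imports "HOL-Analysis.Analysis"
begin

text \<open>
  Continuously differentiable functions of \<open>(x, t)\<close> with \<open>t > 0\<close>;
  \<open>g\<close> is the spatial gradient and \<open>d\<close> the time derivative.
\<close>

definition C1_test_function ::
    "('a::euclidean_space \<times> real \<Rightarrow> real) \<Rightarrow> ('a \<times> real \<Rightarrow> 'a) \<Rightarrow> ('a \<times> real \<Rightarrow> real) \<Rightarrow> bool"
  where "C1_test_function \<phi> g d \<longleftrightarrow>
    (\<forall>z \<in> UNIV \<times> {0<..}. (\<phi> has_derivative (\<lambda>(h, k). g z \<bullet> h + d z * k)) (at z)) \<and>
    continuous_on (UNIV \<times> {0<..}) g \<and> continuous_on (UNIV \<times> {0<..}) d"

text \<open>
  Viscosity sub- and supersolutions of \<open>u\<^sub>t + H(\<nabla>u, x) = 0\<close> for \<open>t > 0\<close>.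
  Continuity of \<open>u\<close> is demanded separately in \<open>viscosity_solution_Cauchy\<close>. Values of \<open>u\<close> at
  negative times are irrelevant, since the points \<open>(x, t)\<close> with \<open>t > 0\<close> form an open set.
\<close>

definition viscosity_subsolution ::
    "('a::euclidean_space \<Rightarrow> 'a \<Rightarrow> real) \<Rightarrow> ('a \<times> real \<Rightarrow> real) \<Rightarrow> bool"
  where "viscosity_subsolution H u \<longleftrightarrow>
    (\<forall>\<phi> g d x t. C1_test_function \<phi> g d \<and> t > 0 \<and>
        (\<forall>\<^sub>F z in nhds (x, t). u z - \<phi> z \<le> u (x, t) - \<phi> (x, t)) \<longrightarrow>
      d (x, t) + H (g (x, t)) x \<le> 0)"

definition viscosity_supersolution ::
    "('a::euclidean_space \<Rightarrow> 'a \<Rightarrow> real) \<Rightarrow> ('a \<times> real \<Rightarrow> real) \<Rightarrow> bool"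
  where "viscosity_supersolution H u \<longleftrightarrow>
    (\<forall>\<phi> g d x t. C1_test_function \<phi> g d \<and> t > 0 \<and>
        (\<forall>\<^sub>F z in nhds (x, t). u z - \<phi> z \<ge> u (x, t) - \<phi> (x, t)) \<longrightarrow>
      d (x, t) + H (g (x, t)) x \<ge> 0)"

definition viscosity_solution_Cauchy ::
    "('a::euclidean_space \<Rightarrow> 'a \<Rightarrow> real) \<Rightarrow> ('a \<Rightarrow> real) \<Rightarrow> ('a \<times> real \<Rightarrow> real) \<Rightarrow> bool"
  where "viscosity_solution_Cauchy H u0 u \<longleftrightarrow>
    continuous_on (UNIV \<times> {0..}) u \<and> (\<forall>x. u (x, 0) = u0 x) \<and>
    viscosity_subsolution H u \<and> viscosity_supersolution H u"

definition G_Hamiltonian ::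
    "('a::euclidean_space \<Rightarrow> 'a) \<Rightarrow> real \<Rightarrow> real \<Rightarrow> 'a \<Rightarrow> 'a \<Rightarrow> real"
  where "G_Hamiltonian V s\<^sub>l K q x = s\<^sub>l * norm q + K * (V x \<bullet> q)"

text \<open>
  For \<open>K \<ge> 0\<close>, \<open>s\<^sub>l > 0\<close> and \<open>V\<close> smooth, periodic and divergence free, the solution \<open>G\<close> exists and
  is unique for \<open>t \<ge> 0\<close> among continuous functions (no growth condition is needed, by finite speed
  of propagation), and the limit exists and does not depend on \<open>x\<close>; so the description below is
  proper.
\<close>

definition turbulent_flame_speed ::
    "('a::euclidean_space \<Rightarrow> 'a) \<Rightarrow> real \<Rightarrow> 'a \<Rightarrow> real \<Rightarrow> real"
  where "turbulent_flame_speed V s\<^sub>l p K =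
    (THE s. \<exists>G. viscosity_solution_Cauchy (G_Hamiltonian V s\<^sub>l K) (\<lambda>x. p \<bullet> x) G \<and>
      (\<forall>x. ((\<lambda>t. - G (x, t) / t) \<longlongrightarrow> s) at_top))"

definition ABC_flow :: "real^3 \<Rightarrow> real^3"
  where "ABC_flow v =
    vector [sin (v$3) + cos (v$2), sin (v$1) + cos (v$3), sin (v$2) + cos (v$1)]"

end

(*
  The Hamiltonian is the supremum of linear ones, so the solution is the value function
  inf p.y over the end points y of polygons whose velocity is within eps = s/K of -V, run for
  the time K t. Hence s_T(p,K)/K is the long-time rate r(eps) of a controlled drift; r is monotone
  in eps, so the limit for K -> infinity exists as soon as r does, and it is positive if
  r is bounded away from 0.

  Existence of r: the maximal displacement in direction p is subadditive in time, and it differs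
  from the displacement of any given starting point by a bounded amount, because every point can be
  steered to every other one modulo periods in bounded time. For the ABC flow the latter follows
  by rounding its three shears to a lattice: this gives a permutation of a finite set, whose
  orbits return.

  Positivity: the flow itself has orbits that travel along each coordinate axis. With x as
  independent variable, shooting from {x = 0, z = pi/2} to {x = pi/4, y + z = pi/2} (both axes of
  time-reversing symmetries) yields an eighth of such an orbit, and reflections complete it. Only
  Euler polygons are needed, since r(eps) tolerates errors of size eps.
*)
theory Submission
  imports Defs
begin

section \<open>Controlled polygons\<close>

text \<open>The speed is defined through a unique viscosity solution, so besides solving the
  equation the value function has to be identified with every other solution on the unbounded space;
  an exponential barrier over a cone localises that comparison. Once time is scaled by K, the
  amplitude enters only through the control radius \<epsilon> = s/K.

  Since \<epsilon> is positive, approximate trajectories suffice. Poincare recurrence of a volume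
  preserving flow becomes recurrence of a lattice permutation, and continuous dependence of orbits
  on their initial data becomes continuity of an explicit recursion. The steering time may blow up
  as \<epsilon> tends to 0, but it enters only the existence of r(\<epsilon>); the lower bound rests
  on orbits whose duration, at most 2 pi, is bounded uniformly in \<epsilon>. The work is done for V
  and carried over to the drift -V, which is V translated by half a period in each
  coordinate.\<close>

definition seg :: "('a::euclidean_space \<Rightarrow> 'a) \<Rightarrow> real \<Rightarrow> 'a \<Rightarrow> 'a \<Rightarrow> real \<Rightarrow> bool"
  where "seg W \<epsilon> x y \<tau> \<longleftrightarrow> 0 \<le> \<tau> \<and> (\<forall>z\<in>closed_segment x y. norm (y - x - \<tau> *\<^sub>R W z) \<le> \<epsilon> * \<tau>)"

inductive reach :: "('a::euclidean_space \<Rightarrow> 'a) \<Rightarrow> real \<Rightarrow> 'a \<Rightarrow> 'a \<Rightarrow> real \<Rightarrow> bool"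
  for W \<epsilon> x where
  reach_refl: "reach W \<epsilon> x x 0"
| reach_step: "reach W \<epsilon> x y t \<Longrightarrow> seg W \<epsilon> y z \<tau> \<Longrightarrow> reach W \<epsilon> x z (t + \<tau>)"

text \<open>Because the drift is tested at every point of a segment, and not only at its start, each
  sub-segment inherits the test with its proportional share of the time.\<close>

lemma seg_sub:
  assumes "seg W \<epsilon> x y \<tau>" "0 \<le> a" "a \<le> b" "b \<le> 1"
  shows "seg W \<epsilon> (x + a *\<^sub>R (y - x)) (x + b *\<^sub>R (y - x)) ((b - a) * \<tau>)"
  unfolding seg_def
proof (intro conjI ballI)
  show "0 \<le> (b - a) * \<tau>" using assms by (simp add: seg_def)
  fix z assume "z \<in> closed_segment (x + a *\<^sub>R (y - x)) (x + b *\<^sub>R (y - x))"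
  then obtain u where u: "0 \<le> u" "u \<le> 1"
    "z = (1 - u) *\<^sub>R (x + a *\<^sub>R (y - x)) + u *\<^sub>R (x + b *\<^sub>R (y - x))"
    by (auto simp: in_segment)
  define w where "w = (1 - u) * a + u * b"
  have "z = (1 - w) *\<^sub>R x + w *\<^sub>R y"
    unfolding u(3) w_def by (simp add: algebra_simps)
  moreover have "0 \<le> w" using u assms by (simp add: w_def)
  moreover have "w \<le> 1"
  proof -
    have "w \<le> (1 - u) * 1 + u * 1" unfolding w_def
      using u assms by (intro add_mono mult_left_mono) auto
    then show ?thesis by simp
  qed
  ultimately have "z \<in> closed_segment x y" by (auto simp: in_segment)
  then have "norm (y - x - \<tau> *\<^sub>R W z) \<le> \<epsilon> * \<tau>" using assms(1) by (simp add: seg_def)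
  then have "(b - a) * norm (y - x - \<tau> *\<^sub>R W z) \<le> (b - a) * (\<epsilon> * \<tau>)"
    using assms by (intro mult_left_mono) auto
  moreover have "x + b *\<^sub>R (y - x) - (x + a *\<^sub>R (y - x)) - ((b - a) * \<tau>) *\<^sub>R W z
      = (b - a) *\<^sub>R (y - x - \<tau> *\<^sub>R W z)"
    by (simp add: algebra_simps)
  ultimately show "norm (x + b *\<^sub>R (y - x) - (x + a *\<^sub>R (y - x)) - ((b - a) * \<tau>) *\<^sub>R W z)
      \<le> \<epsilon> * ((b - a) * \<tau>)"
    using assms by (simp add: mult.left_commute)
qed

lemma reach_nonneg: "reach W \<epsilon> x y t \<Longrightarrow> 0 \<le> t"
  by (induction rule: reach.induct) (auto simp: seg_def)

lemma seg_reach: "seg W \<epsilon> x y \<tau> \<Longrightarrow> reach W \<epsilon> x y \<tau>"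
  using reach_step[OF reach_refl] by force

lemma reach_trans:
  assumes "reach W \<epsilon> x y s" "reach W \<epsilon> y z t"
  shows "reach W \<epsilon> x z (s + t)"
  using assms(2)
proof (induction rule: reach.induct)
  case reach_refl
  then show ?case using assms(1) by simp
next
  case (reach_step y' t z' \<tau>)
  then show ?case using reach.reach_step[of W \<epsilon> x y' "s + t" z' \<tau>] by (simp add: add.assoc)
qed

text \<open>If the cut falls inside the last segment, \<open>seg_sub\<close> divides that segment.
  Splitting at an exact time is what turns polygons into an exact dynamic programming
  principle.\<close>

lemma reach_split:
  assumes "reach W \<epsilon> x y r" "r = s + t" "0 \<le> s" "0 \<le> t"
  shows "\<exists>z. reach W \<epsilon> x z s \<and> reach W \<epsilon> z y t"
  using assms
proof (induction arbitrary: s t rule: reach.induct)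
  case reach_refl
  then have "s = 0" "t = 0" by auto
  then show ?case by (auto intro: reach.reach_refl)
next
  case (reach_step y r z \<tau>)
  show ?case
  proof (cases "s \<le> r")
    case True
    then obtain w where w: "reach W \<epsilon> x w s" "reach W \<epsilon> w y (r - s)"
      using reach_step.IH[of s "r - s"] reach_step.prems by auto
    have "reach W \<epsilon> w z (r - s + \<tau>)" by (rule reach.reach_step[OF w(2) reach_step.hyps(2)])
    moreover have "r - s + \<tau> = t" using reach_step.prems by simp
    ultimately show ?thesis using w by auto
  next
    case False
    then have tp: "0 < \<tau>" using reach_step.prems by auto
    define a where "a = (s - r) / \<tau>"
    have a: "0 \<le> a" "a \<le> 1" "a * \<tau> = s - r" "(1 - a) * \<tau> = t"
      using False reach_step.prems tp by (auto simp: a_def field_simps)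
    have 1: "seg W \<epsilon> y (y + a *\<^sub>R (z - y)) (s - r)"
      using seg_sub[OF reach_step.hyps(2), of 0 a] a by simp
    have 2: "seg W \<epsilon> (y + a *\<^sub>R (z - y)) z t"
      using seg_sub[OF reach_step.hyps(2), of a 1] a by simp
    show ?thesis
      using reach.reach_step[OF reach_step.hyps(1) 1] seg_reach[OF 2] by auto
  qed
qed

lemma reach_mono: "reach W \<epsilon> x y t \<Longrightarrow> \<epsilon> \<le> \<epsilon>' \<Longrightarrow> reach W \<epsilon>' x y t"
proof (induction rule: reach.induct)
  case (reach_step y t z \<tau>)
  have "\<epsilon> * \<tau> \<le> \<epsilon>' * \<tau>" using reach_step by (auto simp: seg_def intro: mult_right_mono)
  then have "seg W \<epsilon>' y z \<tau>" using reach_step.hyps(2) unfolding seg_def by (meson order_trans)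
  then show ?case using reach_step by (auto intro: reach.reach_step)
qed (rule reach.reach_refl)

text \<open>An affine isometry that conjugates the drifts preserves the control error of each
  segment. It serves for periods, for permuting the axes, for a screw motion and for the passage
  from V to -V.\<close>

lemma reach_isometry:
  assumes "linear D" "\<And>v. norm (D v) = norm v" "\<And>v. W' (D v + c) = D (W v)"
    and "reach W \<epsilon> x y t"
  shows "reach W' \<epsilon> (D x + c) (D y + c) t"
  using assms(4)
proof (induction rule: reach.induct)
  case reach_refl
  then show ?case by (rule reach.reach_refl)
next
  case (reach_step y t z \<tau>)
  interpret linear D by fact
  have "seg W' \<epsilon> (D y + c) (D z + c) \<tau>"
    unfolding seg_def
  proof (intro conjI ballI)
    show "0 \<le> \<tau>" using reach_step.hyps(2) by (simp add: seg_def)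
    fix w assume "w \<in> closed_segment (D y + c) (D z + c)"
    then obtain u where u: "0 \<le> u" "u \<le> 1" "w = (1 - u) *\<^sub>R (D y + c) + u *\<^sub>R (D z + c)"
      by (auto simp: in_segment)
    define v where "v = (1 - u) *\<^sub>R y + u *\<^sub>R z"
    have w: "w = D v + c" unfolding u(3) v_def add scale by (simp add: algebra_simps)
    have "v \<in> closed_segment y z" unfolding v_def using u by (auto simp: in_segment)
    then have "norm (z - y - \<tau> *\<^sub>R W v) \<le> \<epsilon> * \<tau>" using reach_step.hyps(2) by (simp add: seg_def)
    moreover have "D z + c - (D y + c) - \<tau> *\<^sub>R W' w = D (z - y - \<tau> *\<^sub>R W v)"
      unfolding w assms(3) by (simp add: diff scale)
    ultimately show "norm (D z + c - (D y + c) - \<tau> *\<^sub>R W' w) \<le> \<epsilon> * \<tau>"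
      using assms(2) by simp
  qed
  then show ?case using reach_step by (auto intro: reach.reach_step)
qed

text \<open>A time-reversing symmetry sends a polygon to one that is traversed backwards. The image
  segments stay admissible because the drift condition does not single out the starting
  point.\<close>

lemma reach_reverse_isometry:
  assumes "linear D" "\<And>v. norm (D v) = norm v" "\<And>v. W' (D v + c) = - D (W v)"
    and "reach W \<epsilon> x y t"
  shows "reach W' \<epsilon> (D y + c) (D x + c) t"
  using assms(4)
proof (induction rule: reach.induct)
  case reach_refl
  then show ?case by (rule reach.reach_refl)
next
  case (reach_step y t z \<tau>)
  interpret linear D by fact
  have "seg W' \<epsilon> (D z + c) (D y + c) \<tau>"
    unfolding seg_def
  proof (intro conjI ballI)
    show "0 \<le> \<tau>" using reach_step.hyps(2) by (simp add: seg_def)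
    fix w assume "w \<in> closed_segment (D z + c) (D y + c)"
    then obtain u where u: "0 \<le> u" "u \<le> 1" "w = (1 - u) *\<^sub>R (D z + c) + u *\<^sub>R (D y + c)"
      by (auto simp: in_segment)
    define v where "v = (1 - u) *\<^sub>R z + u *\<^sub>R y"
    have w: "w = D v + c" unfolding u(3) v_def add scale by (simp add: algebra_simps)
    have "v \<in> closed_segment z y" unfolding v_def using u by (auto simp: in_segment)
    then have "v \<in> closed_segment y z" by (simp add: closed_segment_commute)
    then have "norm (z - y - \<tau> *\<^sub>R W v) \<le> \<epsilon> * \<tau>" using reach_step.hyps(2) by (simp add: seg_def)
    moreover have "D y + c - (D z + c) - \<tau> *\<^sub>R W' w = - D (z - y - \<tau> *\<^sub>R W v)"
      unfolding w assms(3) by (simp add: diff scale)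
    ultimately show "norm (D y + c - (D z + c) - \<tau> *\<^sub>R W' w) \<le> \<epsilon> * \<tau>"
      using assms(2) by simp
  qed
  from reach_trans[OF seg_reach[OF this] reach_step.IH] show ?case by (simp add: add.commute)
qed

text \<open>Estimates that freeze the drift are good only for short durations, while
  \<open>reach\<close> permits long segments; these are first cut into equal pieces.\<close>

lemma reach_small_induct [consumes 2, case_names refl step]:
  assumes "reach W \<epsilon> x y t" "0 < \<delta>"
    and refl: "P x 0"
    and step: "\<And>y t z \<tau>. reach W \<epsilon> x y t \<Longrightarrow> P y t \<Longrightarrow> seg W \<epsilon> y z \<tau> \<Longrightarrow> \<tau> \<le> \<delta> \<Longrightarrow> P z (t + \<tau>)"
  shows "P y t"
  using assms(1)
proof (induction rule: reach.induct)
  case reach_refl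
  then show ?case by (rule refl)
next
  case (reach_step y t z \<tau>)
  have \<tau>: "0 \<le> \<tau>" using reach_step.hyps(2) by (simp add: seg_def)
  obtain n :: nat where n: "\<tau> / \<delta> < real n" using reals_Archimedean2 by blast
  then have np: "0 < n" using \<tau> assms(2) by (metis divide_nonneg_pos not_less of_nat_0 gr0I)
  have small: "\<tau> / n \<le> \<delta>" using n np assms(2) by (simp add: field_simps)
  let ?y = "\<lambda>k::nat. y + (k / n) *\<^sub>R (z - y)"
  have "k \<le> n \<Longrightarrow> reach W \<epsilon> x (?y k) (t + k / n * \<tau>) \<and> P (?y k) (t + k / n * \<tau>)" for k
  proof (induction k)
    case 0
    then show ?case using reach_step by simp
  next
    case (Suc k)
    have s: "seg W \<epsilon> (?y k) (?y (Suc k)) ((Suc k / n - k / n) * \<tau>)"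
      using Suc.prems np by (intro seg_sub[OF reach_step.hyps(2)]) (auto simp: field_simps)
    have e: "(Suc k / n - k / n) * \<tau> = \<tau> / n" using np by (simp add: field_simps)
    have e': "t + k / n * \<tau> + \<tau> / n = t + Suc k / n * \<tau>" using np by (simp add: field_simps)
    have IH: "reach W \<epsilon> x (?y k) (t + k / n * \<tau>)" "P (?y k) (t + k / n * \<tau>)"
      using Suc by auto
    from reach.reach_step[OF IH(1) s[unfolded e]] step[OF IH s[unfolded e] small]
    show ?case unfolding e' by simp
  qed
  from this[of n] show ?case using np by simp
qed

section \<open>Polygons of bounded Lipschitz drifts\<close>

locale drift =
  fixes W :: "'a::euclidean_space \<Rightarrow> 'a" and \<epsilon> M L :: real
  assumes \<epsilon>_pos: "0 < \<epsilon>" and L_nonneg: "0 \<le> L"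
    and bound: "norm (W x) \<le> M" and lipschitz: "norm (W x - W y) \<le> L * norm (x - y)"
begin

lemma M_nonneg: "0 \<le> M" using bound[of undefined] norm_ge_zero order_trans by blast

lemma seg_dist: 
  assumes "seg W \<epsilon> x y \<tau>" shows "norm (y - x) \<le> (M + \<epsilon>) * \<tau>"
proof -
  have \<tau>: "0 \<le> \<tau>" and "norm (y - x - \<tau> *\<^sub>R W x) \<le> \<epsilon> * \<tau>"
    using assms by (auto simp: seg_def)
  moreover have "norm (y - x) \<le> norm (y - x - \<tau> *\<^sub>R W x) + norm (\<tau> *\<^sub>R W x)"
    by (metis diff_add_cancel norm_triangle_ineq)
  moreover have "norm (\<tau> *\<^sub>R W x) \<le> M * \<tau>" using \<tau> bound[of x] by (simp add: mult.commute[of M] mult_left_mono)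
  ultimately show ?thesis by (simp add: algebra_simps)
qed

lemma reach_dist: "reach W \<epsilon> x y t \<Longrightarrow> norm (y - x) \<le> (M + \<epsilon>) * t"
proof (induction rule: reach.induct)
  case (reach_step y t z \<tau>)
  have "norm (z - x) \<le> norm (z - y) + norm (y - x)"
    by (metis add_diff_cancel add_diff_eq diff_add_cancel norm_triangle_ineq)
  then show ?case using seg_dist[OF reach_step.hyps(2)] reach_step.IH by (simp add: algebra_simps)
qed simp

text \<open>The segment stays within (M + \<epsilon>) \<tau> of its start, so the drift varies along
  it by at most L times that. An error \<eta> at the start is therefore admissible as soon as
  \<epsilon> also covers this variation.\<close>

lemma segI:
  assumes "0 \<le> \<tau>" "norm (y - x - \<tau> *\<^sub>R W x) \<le> \<eta> * \<tau>" "\<eta> \<le> \<epsilon>"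
    "\<eta> + L * ((M + \<epsilon>) * \<tau>) \<le> \<epsilon>"
  shows "seg W \<epsilon> x y \<tau>"
  unfolding seg_def
proof (intro conjI ballI)
  show "0 \<le> \<tau>" by fact
  fix z assume z: "z \<in> closed_segment x y"
  have e: "\<eta> * \<tau> \<le> \<epsilon> * \<tau>" using assms by (intro mult_right_mono) auto
  have "norm (y - x) \<le> norm (y - x - \<tau> *\<^sub>R W x) + norm (\<tau> *\<^sub>R W x)"
    by (metis diff_add_cancel norm_triangle_ineq)
  moreover have "norm (\<tau> *\<^sub>R W x) \<le> M * \<tau>" using assms(1) bound[of x] by (simp add: mult.commute[of M] mult_left_mono)
  ultimately have d: "norm (y - x) \<le> (M + \<epsilon>) * \<tau>" using assms(2) e by (simp add: algebra_simps)
  have "norm (z - x) \<le> norm (y - x)" using segment_bound(1)[OF z] .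
  then have l: "norm (W x - W z) \<le> L * ((M + \<epsilon>) * \<tau>)"
    using lipschitz[of x z] d L_nonneg by (metis mult_left_mono norm_minus_commute order_trans)
  have "norm (y - x - \<tau> *\<^sub>R W z) \<le> norm (y - x - \<tau> *\<^sub>R W x) + norm (\<tau> *\<^sub>R (W x - W z))"
    using norm_triangle_ineq[of "y - x - \<tau> *\<^sub>R W x" "\<tau> *\<^sub>R (W x - W z)"] by (simp add: algebra_simps)
  also have "\<dots> \<le> \<eta> * \<tau> + \<tau> * (L * ((M + \<epsilon>) * \<tau>))"
    using assms l by (intro add_mono) (auto intro: mult_left_mono)
  also have "\<dots> = (\<eta> + L * ((M + \<epsilon>) * \<tau>)) * \<tau>" by (simp add: algebra_simps)
  also have "\<dots> \<le> \<epsilon> * \<tau>" using assms by (intro mult_right_mono) auto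
  finally show "norm (y - x - \<tau> *\<^sub>R W z) \<le> \<epsilon> * \<tau>" .
qed

text \<open>Shrinking the control of a given polygon by the factor \<open>1 - \<eta>\<close> leaves room for the error
  made by freezing the drift on a short segment, so the polygon is shadowed from any starting point.\<close>
lemma reach_shadow:
  assumes "reach W \<epsilon> x y t" and \<eta>: "0 < \<eta>" "\<eta> < 1"
  shows "\<exists>y'. reach W \<epsilon> x' y' t \<and> norm (y' - y) \<le> exp (L * t) * (norm (x' - x) + \<eta> * \<epsilon> * t)"
proof -
  \<comment> \<open>The largest duration for which the variation in \<open>segI\<close> is covered
    by \<eta> \<epsilon>; the added 1 keeps the denominator positive when L = 0.\<close>
  define \<delta> where "\<delta> = \<eta> * \<epsilon> / (L * (M + \<epsilon>) + 1)"
  have den: "0 < L * (M + \<epsilon>) + 1"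
    using L_nonneg M_nonneg \<epsilon>_pos by (simp add: add_nonneg_pos)
  have \<delta>: "0 < \<delta>" unfolding \<delta>_def using den \<eta> \<epsilon>_pos by simp
  have \<delta>': "L * ((M + \<epsilon>) * \<delta>) \<le> \<eta> * \<epsilon>"
  proof -
    have "L * ((M + \<epsilon>) * \<delta>) = (L * (M + \<epsilon>)) * \<delta>" by simp
    also have "\<dots> \<le> (L * (M + \<epsilon>) + 1) * \<delta>" using \<delta> by (intro mult_right_mono) auto
    also have "\<dots> = \<eta> * \<epsilon>" using den by (simp add: \<delta>_def)
    finally show ?thesis .
  qed
  from assms(1) \<delta> show ?thesis
  proof (induction rule: reach_small_induct)
    case refl
    then show ?case by (auto intro!: exI[of _ x'] reach_refl)
  next
    case (step y t z \<tau>)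
    then obtain y' where y': "reach W \<epsilon> x' y' t"
      "norm (y' - y) \<le> exp (L * t) * (norm (x' - x) + \<eta> * \<epsilon> * t)" by auto
    have \<tau>: "0 \<le> \<tau>" using step.hyps(2) by (simp add: seg_def)
    have t: "0 \<le> t" using reach_nonneg[OF step.hyps(1)] .
    define v where "v = z - y - \<tau> *\<^sub>R W y"
    have v: "norm v \<le> \<epsilon> * \<tau>" using step.hyps(2) by (simp add: v_def seg_def)
    define z' where "z' = y' + \<tau> *\<^sub>R W y' + (1 - \<eta>) *\<^sub>R v"
    have "seg W \<epsilon> y' z' \<tau>"
    proof (rule segI[OF \<tau>])
      have "norm (z' - y' - \<tau> *\<^sub>R W y') = (1 - \<eta>) * norm v" using \<eta> by (simp add: z'_def)
      also have "\<dots> \<le> (1 - \<eta>) * (\<epsilon> * \<tau>)" using v \<eta> by (intro mult_left_mono) auto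
      finally show "norm (z' - y' - \<tau> *\<^sub>R W y') \<le> ((1 - \<eta>) * \<epsilon>) * \<tau>" by (simp add: mult.assoc)
      show "(1 - \<eta>) * \<epsilon> \<le> \<epsilon>" using \<eta> \<epsilon>_pos by (simp add: algebra_simps)
      have "L * ((M + \<epsilon>) * \<tau>) \<le> L * ((M + \<epsilon>) * \<delta>)"
        using step.hyps(3) L_nonneg M_nonneg \<epsilon>_pos by (intro mult_left_mono) auto
      then show "(1 - \<eta>) * \<epsilon> + L * ((M + \<epsilon>) * \<tau>) \<le> \<epsilon>" using \<delta>' by (simp add: algebra_simps)
    qed
    from reach.reach_step[OF y'(1) this] have r: "reach W \<epsilon> x' z' (t + \<tau>)" .
    let ?A = "norm (x' - x) + \<eta> * \<epsilon> * t"
    have "z' - z = (y' - y) + \<tau> *\<^sub>R (W y' - W y) - \<eta> *\<^sub>R v"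
      by (simp add: z'_def v_def algebra_simps)
    then have "norm (z' - z) \<le> norm (y' - y) + \<tau> * norm (W y' - W y) + \<eta> * norm v"
      using norm_triangle_ineq4[of "(y' - y) + \<tau> *\<^sub>R (W y' - W y)" "\<eta> *\<^sub>R v"]
        norm_triangle_ineq[of "y' - y" "\<tau> *\<^sub>R (W y' - W y)"] \<tau> \<eta> by simp
    also have "\<dots> \<le> norm (y' - y) + \<tau> * (L * norm (y' - y)) + \<eta> * (\<epsilon> * \<tau>)"
      using lipschitz v \<tau> \<eta> by (intro add_mono mult_left_mono) auto
    also have "\<dots> = (1 + L * \<tau>) * norm (y' - y) + \<eta> * \<epsilon> * \<tau>" by (simp add: algebra_simps)
    \<comment> \<open>Discrete Gronwall: 1 + L \<tau> is at most exp (L \<tau>), and the new error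
      is inflated by a factor at least 1 so that both terms share one exponential.\<close>
    also have "\<dots> \<le> exp (L * \<tau>) * (exp (L * t) * ?A) + exp (L * (t + \<tau>)) * (\<eta> * \<epsilon> * \<tau>)"
    proof (rule add_mono)
      show "(1 + L * \<tau>) * norm (y' - y) \<le> exp (L * \<tau>) * (exp (L * t) * ?A)"
        using y'(2) exp_ge_add_one_self[of "L * \<tau>"] by (intro mult_mono) auto
      have "1 \<le> exp (L * (t + \<tau>))" using L_nonneg t \<tau> by simp
      then show "\<eta> * \<epsilon> * \<tau> \<le> exp (L * (t + \<tau>)) * (\<eta> * \<epsilon> * \<tau>)"
        using \<eta> \<epsilon>_pos \<tau> mult_right_mono[of 1 "exp (L * (t + \<tau>))" "\<eta> * \<epsilon> * \<tau>"] by simp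
    qed
    also have "\<dots> = exp (L * (t + \<tau>)) * (norm (x' - x) + \<eta> * \<epsilon> * (t + \<tau>))"
      by (simp add: exp_add algebra_simps)
    finally show ?case using r by auto
  qed
qed

text \<open>Short Euler steps with zero control are admissible since \<epsilon> is positive. Hence
  the infimum in \<open>front_value\<close> runs over a nonempty set.\<close>

lemma reach_exists: 
  assumes "0 \<le> t" shows "\<exists>y. reach W \<epsilon> x y t"
proof -
  define \<delta> where "\<delta> = \<epsilon> / (L * (M + \<epsilon>) + 1)"
  have den: "0 < L * (M + \<epsilon>) + 1"
    using L_nonneg M_nonneg \<epsilon>_pos by (simp add: add_nonneg_pos)
  have \<delta>: "0 < \<delta>" unfolding \<delta>_def using den \<epsilon>_pos by simp
  have \<delta>': "L * ((M + \<epsilon>) * \<delta>) \<le> \<epsilon>"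
  proof -
    have "L * ((M + \<epsilon>) * \<delta>) = (L * (M + \<epsilon>)) * \<delta>" by simp
    also have "\<dots> \<le> (L * (M + \<epsilon>) + 1) * \<delta>" using \<delta> by (intro mult_right_mono) auto
    also have "\<dots> = \<epsilon>" using den by (simp add: \<delta>_def)
    finally show ?thesis .
  qed
  have short: "\<exists>y. reach W \<epsilon> x y s" if "0 \<le> s" "s \<le> \<delta>" for x s
  proof -
    have "L * ((M + \<epsilon>) * s) \<le> L * ((M + \<epsilon>) * \<delta>)"
      using that L_nonneg M_nonneg \<epsilon>_pos by (intro mult_left_mono) auto
    then have "seg W \<epsilon> x (x + s *\<^sub>R W x) s"
      using that \<delta>' \<epsilon>_pos by (intro segI[where \<eta> = 0]) auto
    then show ?thesis by (blast intro: seg_reach)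
  qed
  obtain n :: nat where n: "t / \<delta> < real n" using reals_Archimedean2 by blast
  then have np: "0 < n" using assms \<delta> by (metis divide_nonneg_pos not_less of_nat_0 gr0I)
  have small: "t / n \<le> \<delta>" using n np \<delta> by (simp add: field_simps)
  have "\<exists>y. reach W \<epsilon> x y (k * (t / n))" for k :: nat
  proof (induction k)
    case 0
    then show ?case by (auto intro: reach_refl)
  next
    case (Suc k)
    then obtain y where y: "reach W \<epsilon> x y (k * (t / n))" by auto
    obtain z where z: "reach W \<epsilon> y z (t / n)" using short[of "t / n" y] assms small by auto
    from reach_trans[OF y z] have "reach W \<epsilon> x z (Suc k * (t / n))" by (simp add: algebra_simps add_divide_distrib)
    then show ?case by blast
  qed
  from this[of n] show ?thesis using np by simp
qed

end

section \<open>The value function and its equation\<close>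

definition front_value :: "('a::euclidean_space \<Rightarrow> 'a) \<Rightarrow> real \<Rightarrow> 'a \<Rightarrow> 'a \<Rightarrow> real \<Rightarrow> real"
  where "front_value W \<epsilon> p x t = (INF y\<in>{y. reach W \<epsilon> x y t}. p \<bullet> y)"

lemma C1_test_functionD:
  assumes "C1_test_function \<phi> g d" "0 < t" "0 < e"
  obtains r where "0 < r" "\<And>y s. norm (y - x) + \<bar>s - t\<bar> < r \<Longrightarrow>
    \<bar>\<phi> (y, s) - \<phi> (x, t) - (g (x, t) \<bullet> (y - x) + d (x, t) * (s - t))\<bar> \<le> e * (norm (y - x) + \<bar>s - t\<bar>)"
proof -
  have "(\<phi> has_derivative (\<lambda>(h, k). g (x, t) \<bullet> h + d (x, t) * k)) (at (x, t))"
    using assms by (auto simp: C1_test_function_def)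
  then obtain r where r: "0 < r" "\<And>z. norm (z - (x, t)) < r \<Longrightarrow>
     norm (\<phi> z - \<phi> (x, t) - (case z - (x, t) of (h, k) \<Rightarrow> g (x, t) \<bullet> h + d (x, t) * k)) \<le> e * norm (z - (x, t))"
    unfolding has_derivative_at_alt using assms(3) by blast
  have n: "norm ((y, s) - (x, t)) \<le> norm (y - x) + \<bar>s - t\<bar>" for y s
    using norm_Pair_le[of "y - x" "s - t"] by simp
  show thesis
  proof (rule that[OF r(1)])
    fix y s assume "norm (y - x) + \<bar>s - t\<bar> < r"
    then have "norm ((y, s) - (x, t)) < r" using n[of y s] by simp
    from r(2)[OF this] n[of y s] assms(3)
    show "\<bar>\<phi> (y, s) - \<phi> (x, t) - (g (x, t) \<bullet> (y - x) + d (x, t) * (s - t))\<bar> \<le> e * (norm (y - x) + \<bar>s - t\<bar>)"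
      by simp (meson less_imp_le mult_left_mono order_trans)
  qed
qed

lemma eventually_nhds_PairD:
  assumes "\<forall>\<^sub>F z in nhds (x, t::real). P z"
  obtains r where "0 < r" "\<And>y s. norm (y - x) + \<bar>s - t\<bar> < r \<Longrightarrow> P (y, s)"
proof -
  obtain r where r: "0 < r" "\<And>z. dist z (x, t) < r \<Longrightarrow> P z"
    using assms by (auto simp: eventually_nhds_metric)
  show thesis
  proof (rule that[OF r(1)])
    fix y s assume "norm (y - x) + \<bar>s - t\<bar> < r"
    then show "P (y, s)" using norm_Pair_le[of "y - x" "s - t"] by (intro r(2)) (simp add: dist_norm)
  qed
qed

section \<open>Dynamic programming and Lipschitz bounds\<close>

context drift begin

abbreviation "val \<equiv> front_value W \<epsilon>"

lemma reach_inner_bound: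
  assumes "reach W \<epsilon> x y t" shows "\<bar>p \<bullet> y - p \<bullet> x\<bar> \<le> norm p * ((M + \<epsilon>) * t)"
proof -
  have "\<bar>p \<bullet> (y - x)\<bar> \<le> norm p * norm (y - x)" by (rule Cauchy_Schwarz_ineq2)
  also have "\<dots> \<le> norm p * ((M + \<epsilon>) * t)" using reach_dist[OF assms] by (intro mult_left_mono) auto
  finally show ?thesis by (simp add: inner_diff_right)
qed

lemma reach_bdd_below: "bdd_below ((\<lambda>y. p \<bullet> y) ` {y. reach W \<epsilon> x y t})"
proof (rule bdd_belowI2)
  fix y assume "y \<in> {y. reach W \<epsilon> x y t}"
  then show "p \<bullet> x - norm p * ((M + \<epsilon>) * t) \<le> p \<bullet> y" using reach_inner_bound[of x y t p] by auto
qed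

lemma val_le: "reach W \<epsilon> x y t \<Longrightarrow> val p x t \<le> p \<bullet> y"
  unfolding front_value_def by (rule cINF_lower[OF reach_bdd_below]) simp

lemma val_greatest: 
  assumes "0 \<le> t" "\<And>y. reach W \<epsilon> x y t \<Longrightarrow> c \<le> p \<bullet> y" shows "c \<le> val p x t"
  unfolding front_value_def using reach_exists[OF assms(1), of x] assms(2)
  by (intro cINF_greatest) auto

lemma val_approx:
  assumes "0 \<le> t" "0 < e" shows "\<exists>y. reach W \<epsilon> x y t \<and> p \<bullet> y < val p x t + e"
proof (rule ccontr)
  assume "\<not> ?thesis"
  then have "val p x t + e \<le> val p x t" by (intro val_greatest assms) (auto simp: not_less)
  then show False using assms by simp
qed

lemma val_0: "val p x 0 = p \<bullet> x"
proof (rule antisym)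
  show "val p x 0 \<le> p \<bullet> x" by (rule val_le[OF reach_refl])
  show "p \<bullet> x \<le> val p x 0" by (rule val_greatest) (use reach_dist in force)+
qed

lemma val_reach_le:
  assumes "reach W \<epsilon> x y s" "0 \<le> t" shows "val p x (s + t) \<le> val p y t"
  by (rule val_greatest[OF assms(2)]) (rule val_le[OF reach_trans[OF assms(1)]])

text \<open>Together with \<open>val_reach_le\<close> this is the dynamic programming principle; the
  gap \<open>e\<close> is there because the infimum may fail to be attained.\<close>

lemma val_reach_approx:
  assumes "0 \<le> s" "0 \<le> t" "0 < e"
  shows "\<exists>y. reach W \<epsilon> x y s \<and> val p y t < val p x (s + t) + e"
proof -
  obtain z where z: "reach W \<epsilon> x z (s + t)" "p \<bullet> z < val p x (s + t) + e"
    using val_approx[of "s + t" e x p] assms by auto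
  obtain y where "reach W \<epsilon> x y s" "reach W \<epsilon> y z t"
    using reach_split[OF z(1) refl] assms by auto
  then show ?thesis using z(2) val_le[of y z t p] by force
qed

text \<open>The bound \<open>m\<close> is uniform in the starting point, so it applies at the
  unknown intermediate point. This gives Lipschitz continuity in time here and subadditivity of the
  maximal displacement later.\<close>

lemma val_add_ge:
  assumes "0 \<le> s" "0 \<le> t" "\<And>y. p \<bullet> y - m \<le> val p y t"
  shows "val p x s - m \<le> val p x (s + t)"
proof (rule field_le_epsilon)
  fix e :: real assume "0 < e"
  then obtain y where "reach W \<epsilon> x y s" "val p y t < val p x (s + t) + e"
    using val_reach_approx assms by blast
  then show "val p x s - m \<le> val p x (s + t) + e" using val_le[of x y s p] assms(3)[of y] by simp
qed

lemma val_add_le: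
  assumes "0 \<le> s" "0 \<le> t" "\<And>y. val p y t \<le> p \<bullet> y + m"
  shows "val p x (s + t) \<le> val p x s + m"
proof -
  have "val p x (s + t) - m \<le> val p x s"
  proof (rule val_greatest[OF assms(1)])
    fix y assume "reach W \<epsilon> x y s"
    then show "val p x (s + t) - m \<le> p \<bullet> y" using val_reach_le[of x y s t p] assms by (smt (verit))
  qed
  then show ?thesis by simp
qed

lemma val_bound:
  assumes "0 \<le> t" shows "\<bar>val p x t - p \<bullet> x\<bar> \<le> norm p * ((M + \<epsilon>) * t)"
proof -
  obtain y where y: "reach W \<epsilon> x y t" using reach_exists[OF assms] by blast
  have "p \<bullet> x - norm p * ((M + \<epsilon>) * t) \<le> val p x t"
    using reach_inner_bound[of x _ t p] by (intro val_greatest[OF assms]) (smt (verit))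
  moreover have "val p x t \<le> p \<bullet> x + norm p * ((M + \<epsilon>) * t)"
    using val_le[OF y, of p] reach_inner_bound[OF y, of p] by (simp add: abs_le_iff)
  ultimately show ?thesis by (simp add: abs_le_iff)
qed

lemma val_lipschitz_time:
  assumes "0 \<le> s" "0 \<le> t" shows "\<bar>val p x s - val p x t\<bar> \<le> norm p * (M + \<epsilon>) * \<bar>s - t\<bar>"
proof -
  have *: "\<bar>val p x (s + \<tau>) - val p x s\<bar> \<le> norm p * ((M + \<epsilon>) * \<tau>)" if "0 \<le> s" "0 \<le> \<tau>" for s \<tau>
  proof -
    have b: "\<bar>val p y \<tau> - p \<bullet> y\<bar> \<le> norm p * ((M + \<epsilon>) * \<tau>)" for y by (rule val_bound[OF that(2)])
    have "val p x s - norm p * ((M + \<epsilon>) * \<tau>) \<le> val p x (s + \<tau>)"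
      using b by (intro val_add_ge[OF that]) (smt (verit))
    moreover have "val p x (s + \<tau>) \<le> val p x s + norm p * ((M + \<epsilon>) * \<tau>)"
      using b by (intro val_add_le[OF that]) (smt (verit))
    ultimately show ?thesis by (simp add: abs_le_iff)
  qed
  show ?thesis using *[of s "t - s"] *[of t "s - t"] assms
    by (cases "s \<le> t") (auto simp: abs_minus_commute mult.assoc)
qed

text \<open>A nearly optimal polygon from one point is shadowed from the other; the loss caused by
  shrinking its control vanishes in the limit.\<close>

lemma val_lipschitz_space:
  assumes "0 \<le> t" shows "\<bar>val p x t - val p x' t\<bar> \<le> norm p * (exp (L * t) * norm (x - x'))"
proof -
  have *: "val p x' t \<le> val p x t + norm p * (exp (L * t) * norm (x' - x))" for x x'
  proof -
    have 1: "val p x' t \<le> val p x t + e + norm p * (exp (L * t) * (norm (x' - x) + \<eta> * \<epsilon> * t))"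
      if e: "0 < e" and \<eta>: "0 < \<eta>" "\<eta> < 1" for e \<eta>
    proof -
      obtain y where y: "reach W \<epsilon> x y t" "p \<bullet> y < val p x t + e"
        using val_approx[OF assms e] by blast
      obtain y' where y': "reach W \<epsilon> x' y' t"
        "norm (y' - y) \<le> exp (L * t) * (norm (x' - x) + \<eta> * \<epsilon> * t)"
        using reach_shadow[OF y(1) \<eta>] by blast
      have "p \<bullet> (y' - y) \<le> norm p * norm (y' - y)" by (rule norm_cauchy_schwarz)
      also have "\<dots> \<le> norm p * (exp (L * t) * (norm (x' - x) + \<eta> * \<epsilon> * t))"
        using y'(2) by (intro mult_left_mono) auto
      finally show ?thesis using val_le[OF y'(1), of p] y(2) by (simp add: inner_diff_right)
    qed
    \<comment> \<open>One variable plays both the optimality gap and the shrinking factor, so a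
      single limit removes both.\<close>
    have "((\<lambda>\<eta>. val p x t + \<eta> + norm p * (exp (L * t) * (norm (x' - x) + \<eta> * \<epsilon> * t)))
        \<longlongrightarrow> val p x t + 0 + norm p * (exp (L * t) * (norm (x' - x) + 0 * \<epsilon> * t))) (at_right 0)"
      by (intro tendsto_intros)
    moreover have "\<forall>\<^sub>F \<eta> in at_right 0.
      val p x' t \<le> val p x t + \<eta> + norm p * (exp (L * t) * (norm (x' - x) + \<eta> * \<epsilon> * t))"
      using eventually_at_right_real[of 0 1] by (auto elim!: eventually_mono intro: 1)
    ultimately show ?thesis using tendsto_lowerbound[of _ _ "at_right (0::real)"] by fastforce
  qed
  show ?thesis using *[of x x'] *[of x' x] by (simp add: abs_le_iff norm_minus_commute)
qed

lemma val_continuous: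
  assumes "0 \<le> K" shows "continuous_on (UNIV \<times> {0..}) (\<lambda>(x, t). val p x (K * t))"
  unfolding continuous_on_def
proof
  fix z0 :: "'a \<times> real" assume "z0 \<in> UNIV \<times> {0..}"
  then obtain x0 t0 where z0: "z0 = (x0, t0)" and t0: "0 \<le> t0" by auto
  let ?F = "at (x0, t0) within UNIV \<times> {0..}"
  let ?b = "\<lambda>z. norm p * (M + \<epsilon>) * \<bar>K * snd z - K * t0\<bar> + norm p * (exp (L * (K * t0)) * norm (fst z - x0))"
  have "((\<lambda>z. val p (fst z) (K * snd z) - val p x0 (K * t0)) \<longlongrightarrow> 0) ?F"
  proof (rule Lim_null_comparison)
    have "(?b \<longlongrightarrow> norm p * (M + \<epsilon>) * \<bar>K * snd (x0, t0) - K * t0\<bar> + norm p * (exp (L * (K * t0)) * norm (fst (x0, t0) - x0))) ?F"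
      by (intro tendsto_intros)
    then show "(?b \<longlongrightarrow> 0) ?F" by simp
    show "\<forall>\<^sub>F z in ?F. norm (val p (fst z) (K * snd z) - val p x0 (K * t0)) \<le> ?b z"
      unfolding eventually_at_filter
    proof (intro always_eventually allI impI)
      fix z :: "'a \<times> real" assume z: "z \<in> UNIV \<times> {0..}"
      have 1: "0 \<le> K * snd z" "0 \<le> K * t0" using z t0 assms by auto
      show "norm (val p (fst z) (K * snd z) - val p x0 (K * t0)) \<le> ?b z"
        using val_lipschitz_time[OF 1, of p "fst z"] val_lipschitz_space[OF 1(2), of p "fst z" x0]
        by (simp add: abs_le_iff)
    qed
  qed
  then have "((\<lambda>z. val p (fst z) (K * snd z)) \<longlongrightarrow> val p x0 (K * t0)) ?F" by (rule LIM_zero_cancel)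
  then show "((\<lambda>(x, t). val p x (K * t)) \<longlongrightarrow> (case z0 of (x, t) \<Rightarrow> val p x (K * t))) (at z0 within UNIV \<times> {0..})"
    by (simp add: z0 case_prod_unfold)
qed

section \<open>The value function as a viscosity solution\<close>

lemma reach_first_order:
  "reach W \<epsilon> x y t \<Longrightarrow> norm (y - x - t *\<^sub>R W x) \<le> \<epsilon> * t + L * (M + \<epsilon>) * t^2"
proof (induction rule: reach.induct)
  case (reach_step y t z \<tau>)
  have \<tau>: "0 \<le> \<tau>" "norm (z - y - \<tau> *\<^sub>R W y) \<le> \<epsilon> * \<tau>"
    using reach_step.hyps(2) by (auto simp: seg_def)
  have t: "0 \<le> t" using reach_nonneg[OF reach_step.hyps(1)] .
  have "norm (W y - W x) \<le> L * ((M + \<epsilon>) * t)"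
    using lipschitz[of y x] reach_dist[OF reach_step.hyps(1)] L_nonneg by (meson mult_left_mono order_trans)
  then have w: "norm (\<tau> *\<^sub>R (W y - W x)) \<le> \<tau> * (L * ((M + \<epsilon>) * t))" using \<tau> by (simp add: mult_left_mono)
  have "z - x - (t + \<tau>) *\<^sub>R W x = (z - y - \<tau> *\<^sub>R W y) + \<tau> *\<^sub>R (W y - W x) + (y - x - t *\<^sub>R W x)"
    by (simp add: algebra_simps)
  then have "norm (z - x - (t + \<tau>) *\<^sub>R W x) \<le> \<epsilon> * \<tau> + \<tau> * (L * ((M + \<epsilon>) * t)) + (\<epsilon> * t + L * (M + \<epsilon>) * t^2)"
    using \<tau>(2) w reach_step.IH by (simp only:) (intro norm_triangle_le add_mono)
  also have "\<dots> \<le> \<epsilon> * (t + \<tau>) + L * (M + \<epsilon>) * (t + \<tau>)^2"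
  proof -
    have "0 \<le> L * (M + \<epsilon>) * (\<tau> * t + \<tau>^2)" using \<tau> t L_nonneg M_nonneg \<epsilon>_pos by simp
    then show ?thesis by (simp add: algebra_simps power2_eq_square)
  qed
  finally show ?case .
qed simp

text \<open>The Hamiltonian is the maximum over norm a \<le> \<epsilon> of -K q.(W x + a), so it
  suffices to test one constant control \<open>a\<close> at a time, along a straight segment leading
  from time t down to t - \<tau> / K. The margin \<eta> pays for freezing the drift and tends to 0
  at the end.\<close>

lemma val_subsolution:
  assumes K: "0 < K"
  shows "viscosity_subsolution (\<lambda>q x. K * (\<epsilon> * norm q - W x \<bullet> q)) (\<lambda>(x, t). val p x (K * t))"
  unfolding viscosity_subsolution_def
proof (intro allI impI, elim conjE)
  fix \<phi> g d x and t :: real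
  assume C1: "C1_test_function \<phi> g d" and t: "0 < t"
    and "\<forall>\<^sub>F z in nhds (x, t). (case z of (x, t) \<Rightarrow> val p x (K * t)) - \<phi> z
      \<le> (case (x, t) of (x, t) \<Rightarrow> val p x (K * t)) - \<phi> (x, t)"
  then obtain r1 where r1: "0 < r1" "\<And>y s. norm (y - x) + \<bar>s - t\<bar> < r1 \<Longrightarrow>
      val p y (K * s) - \<phi> (y, s) \<le> val p x (K * t) - \<phi> (x, t)"
    by (elim eventually_nhds_PairD) auto
  let ?g = "g (x, t)" and ?d = "d (x, t)"
  define B where "B = M + \<epsilon> + 1 / K"
  have B: "0 < B" using M_nonneg \<epsilon>_pos K by (simp add: B_def add_nonneg_pos)
  have ineq: "?d / K - ?g \<bullet> (W x + a) \<le> e * B" if a: "norm a \<le> (1 - \<eta>) * \<epsilon>" and \<eta>: "0 < \<eta>" "\<eta> < 1" and e: "0 < e" for a \<eta> e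
  proof -
    obtain r2 where r2: "0 < r2" "\<And>y s. norm (y - x) + \<bar>s - t\<bar> < r2 \<Longrightarrow>
      \<bar>\<phi> (y, s) - \<phi> (x, t) - (?g \<bullet> (y - x) + ?d * (s - t))\<bar> \<le> e * (norm (y - x) + \<bar>s - t\<bar>)"
      using C1_test_functionD[OF C1 t e] by blast
    \<comment> \<open>Small enough to stay in both neighbourhoods when moving in space-time at speed
      at most \<open>B\<close>, to keep the remaining time nonnegative, and to make the segment
      admissible.\<close>
    define r where "r = min (min (r1 / (2 * B)) (r2 / (2 * B))) (min (K * t) (\<eta> * \<epsilon> / (L * (M + \<epsilon>) + 1)))"
    have den: "0 < L * (M + \<epsilon>) + 1" using L_nonneg M_nonneg \<epsilon>_pos by (simp add: add_nonneg_pos)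
    define \<tau> where "\<tau> = r"
    have \<tau>: "0 < \<tau>" "\<tau> \<le> r1 / (2 * B)" "\<tau> \<le> r2 / (2 * B)" "\<tau> \<le> K * t" "\<tau> \<le> \<eta> * \<epsilon> / (L * (M + \<epsilon>) + 1)"
      using r1(1) r2(1) B K t \<eta> \<epsilon>_pos den by (auto simp: r_def \<tau>_def)
    have \<tau>1: "B * \<tau> < r1" and \<tau>2: "B * \<tau> < r2" using \<tau> B r1(1) r2(1) by (auto simp: field_simps)
    define y where "y = x + \<tau> *\<^sub>R (W x + a)"
    define s where "s = t - \<tau> / K"
    have seg: "seg W \<epsilon> x y \<tau>"
    proof (rule segI)
      show "0 \<le> \<tau>" using \<tau> by simp
      show "norm (y - x - \<tau> *\<^sub>R W x) \<le> ((1 - \<eta>) * \<epsilon>) * \<tau>"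
        using a \<tau>(1) by (simp add: y_def scaleR_add_right mult.commute mult_left_mono)
      show "(1 - \<eta>) * \<epsilon> \<le> \<epsilon>" using \<eta> \<epsilon>_pos by (simp add: algebra_simps)
      have "(L * (M + \<epsilon>) + 1) * \<tau> \<le> \<eta> * \<epsilon>" using \<tau>(5) den by (simp add: field_simps)
      then show "(1 - \<eta>) * \<epsilon> + L * ((M + \<epsilon>) * \<tau>) \<le> \<epsilon>" using \<tau>(1) by (simp add: algebra_simps)
    qed
    have st: "\<bar>s - t\<bar> = \<tau> / K" using \<tau> K by (simp add: s_def)
    have dist: "norm (y - x) + \<bar>s - t\<bar> \<le> B * \<tau>" using seg_dist[OF seg] unfolding st by (simp add: B_def algebra_simps)
    have Ks: "K * s = K * t - \<tau>" using K by (simp add: s_def algebra_simps)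
    have "val p x (K * t) \<le> val p y (K * s)"
      using val_reach_le[OF seg_reach[OF seg], of "K * s" p] \<tau>(4) unfolding Ks by simp
    then have "\<phi> (x, t) \<le> \<phi> (y, s)" using r1(2)[of y s] dist \<tau>1 by simp
    moreover have "\<bar>\<phi> (y, s) - \<phi> (x, t) - (?g \<bullet> (y - x) + ?d * (s - t))\<bar> \<le> e * (B * \<tau>)"
      using r2(2)[of y s] dist \<tau>2 e by (smt (verit) mult_left_mono)
    ultimately have "- (?g \<bullet> (y - x) + ?d * (s - t)) \<le> e * (B * \<tau>)" by linarith
    then have "\<tau> * (?d / K - ?g \<bullet> (W x + a)) \<le> \<tau> * (e * B)"
      by (simp add: y_def s_def algebra_simps)
    then show ?thesis using \<tau>(1) by simp
  qed
  have ineq2: "?d / K - ?g \<bullet> (W x + a) \<le> 0" if "norm a \<le> (1 - \<eta>) * \<epsilon>" "0 < \<eta>" "\<eta> < 1" for a \<eta>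
  proof (rule field_le_epsilon)
    fix e :: real assume "0 < e"
    then show "?d / K - ?g \<bullet> (W x + a) \<le> 0 + e" using ineq[OF that, of "e / B"] B by simp
  qed
  have ineq3: "?d / K - ?g \<bullet> W x + (1 - \<eta>) * \<epsilon> * norm ?g \<le> 0" if \<eta>: "0 < \<eta>" "\<eta> < 1" for \<eta>
  proof -
    \<comment> \<open>The maximising control points against the gradient; for a zero gradient
      \<open>sgn\<close> gives the zero control.\<close>
    define a where "a = - ((1 - \<eta>) * \<epsilon>) *\<^sub>R sgn ?g"
    have "norm a \<le> (1 - \<eta>) * \<epsilon>" using \<eta> \<epsilon>_pos by (simp add: a_def norm_sgn)
    moreover have "?g \<bullet> a = - ((1 - \<eta>) * \<epsilon> * norm ?g)"
    proof -
      have "?g \<bullet> sgn ?g = norm ?g" 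
        by (cases "?g = 0") (simp_all add: sgn_div_norm dot_square_norm power2_eq_square)
      then show ?thesis by (simp add: a_def)
    qed
    ultimately show ?thesis using ineq2[OF _ \<eta>, of a] by (simp add: inner_add_right)
  qed
  have "((\<lambda>\<eta>. ?d / K - ?g \<bullet> W x + (1 - \<eta>) * \<epsilon> * norm ?g) \<longlongrightarrow> ?d / K - ?g \<bullet> W x + (1 - 0) * \<epsilon> * norm ?g) (at_right 0)"
    by (intro tendsto_intros)
  moreover have "\<forall>\<^sub>F \<eta> in at_right 0. ?d / K - ?g \<bullet> W x + (1 - \<eta>) * \<epsilon> * norm ?g \<le> 0"
    using eventually_at_right_real[of 0 1] by (auto elim!: eventually_mono intro: ineq3)
  ultimately have "?d / K - ?g \<bullet> W x + (1 - 0) * \<epsilon> * norm ?g \<le> 0"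
    by (intro tendsto_upperbound[of _ _ "at_right (0::real)"]) auto
  then have "K * (?d / K - ?g \<bullet> W x + \<epsilon> * norm ?g) \<le> 0" using K by (simp add: mult_le_0_iff)
  then show "?d + K * (\<epsilon> * norm ?g - W x \<bullet> ?g) \<le> 0" using K by (simp add: algebra_simps inner_commute)
qed

text \<open>A nearly optimal polygon replaces the constant control. By
  \<open>reach_first_order\<close> its chord is \<tau> W x up to \<epsilon> \<tau> plus a quadratic
  remainder, so only its end points enter the estimate.\<close>

lemma val_supersolution:
  assumes K: "0 < K"
  shows "viscosity_supersolution (\<lambda>q x. K * (\<epsilon> * norm q - W x \<bullet> q)) (\<lambda>(x, t). val p x (K * t))"
  unfolding viscosity_supersolution_def
proof (intro allI impI, elim conjE)
  fix \<phi> g d x and t :: real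
  assume C1: "C1_test_function \<phi> g d" and t: "0 < t"
    and "\<forall>\<^sub>F z in nhds (x, t). (case z of (x, t) \<Rightarrow> val p x (K * t)) - \<phi> z
      \<ge> (case (x, t) of (x, t) \<Rightarrow> val p x (K * t)) - \<phi> (x, t)"
  then obtain r1 where r1: "0 < r1" "\<And>y s. norm (y - x) + \<bar>s - t\<bar> < r1 \<Longrightarrow>
      val p y (K * s) - \<phi> (y, s) \<ge> val p x (K * t) - \<phi> (x, t)"
    by (elim eventually_nhds_PairD) auto
  let ?g = "g (x, t)" and ?d = "d (x, t)"
  define B where "B = M + \<epsilon> + 1 / K"
  have B: "0 < B" using M_nonneg \<epsilon>_pos K by (simp add: B_def add_nonneg_pos)
  define C where "C = 1 + norm ?g * (L * (M + \<epsilon>))"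
  have C: "0 < C" using L_nonneg M_nonneg \<epsilon>_pos by (simp add: C_def add_pos_nonneg)
  have "?g \<bullet> W x - \<epsilon> * norm ?g - ?d / K \<le> 0"
  proof (rule field_le_epsilon)
    fix e0 :: real assume e0: "0 < e0"
    define e where "e = e0 / (2 * B)"
    have e: "0 < e" using e0 B by (simp add: e_def)
    obtain r2 where r2: "0 < r2" "\<And>y s. norm (y - x) + \<bar>s - t\<bar> < r2 \<Longrightarrow>
      \<bar>\<phi> (y, s) - \<phi> (x, t) - (?g \<bullet> (y - x) + ?d * (s - t))\<bar> \<le> e * (norm (y - x) + \<bar>s - t\<bar>)"
      using C1_test_functionD[OF C1 t e] by blast
    define \<tau> where "\<tau> = min (min (r1 / (2 * B)) (r2 / (2 * B))) (min (K * t) (e0 / (2 * C)))"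
    have \<tau>: "0 < \<tau>" "\<tau> \<le> r1 / (2 * B)" "\<tau> \<le> r2 / (2 * B)" "\<tau> \<le> K * t" "\<tau> \<le> e0 / (2 * C)"
      using r1(1) r2(1) B K t e0 C by (auto simp: \<tau>_def)
    have \<tau>1: "B * \<tau> < r1" and \<tau>2: "B * \<tau> < r2" using \<tau> B r1(1) r2(1) by (auto simp: field_simps)
    define s where "s = t - \<tau> / K"
    have st: "\<bar>s - t\<bar> = \<tau> / K" using \<tau> K by (simp add: s_def)
    have Ks: "K * s = K * t - \<tau>" using K by (simp add: s_def algebra_simps)
    \<comment> \<open>The gap \<tau>^2 still tends to 0 after the division by \<tau>.\<close>
    obtain y where y: "reach W \<epsilon> x y \<tau>" "val p y (K * s) < val p x (K * t) + \<tau>^2"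
      using val_reach_approx[of \<tau> "K * s" "\<tau>^2" x p] \<tau> unfolding Ks by auto
    have dist: "norm (y - x) + \<bar>s - t\<bar> \<le> B * \<tau>" using reach_dist[OF y(1)] unfolding st by (simp add: B_def algebra_simps)
    have "\<phi> (y, s) \<le> \<phi> (x, t) + \<tau>^2" using r1(2)[of y s] dist \<tau>1 y(2) by simp
    moreover have "\<bar>\<phi> (y, s) - \<phi> (x, t) - (?g \<bullet> (y - x) + ?d * (s - t))\<bar> \<le> e * (B * \<tau>)"
      using r2(2)[of y s] dist \<tau>2 e by (smt (verit) mult_left_mono)
    ultimately have 1: "?g \<bullet> (y - x) + ?d * (s - t) \<le> \<tau>^2 + e * (B * \<tau>)" by linarith
    have "- (?g \<bullet> (y - x - \<tau> *\<^sub>R W x)) \<le> norm ?g * norm (y - x - \<tau> *\<^sub>R W x)"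
      using Cauchy_Schwarz_ineq2[of ?g "y - x - \<tau> *\<^sub>R W x"] by linarith
    also have "\<dots> \<le> norm ?g * (\<epsilon> * \<tau> + L * (M + \<epsilon>) * \<tau>^2)"
      using reach_first_order[OF y(1)] by (intro mult_left_mono) auto
    finally have "\<tau> * (?g \<bullet> W x) - norm ?g * (\<epsilon> * \<tau> + L * (M + \<epsilon>) * \<tau>^2) \<le> ?g \<bullet> (y - x)"
      by (simp add: inner_diff_right)
    with 1 have "\<tau> * (?g \<bullet> W x - \<epsilon> * norm ?g - ?d / K) \<le> \<tau> * (C * \<tau> + e * B)"
      by (simp add: C_def s_def algebra_simps power2_eq_square)
    then have "?g \<bullet> W x - \<epsilon> * norm ?g - ?d / K \<le> C * \<tau> + e * B" using \<tau>(1) by simp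
    also have "\<dots> \<le> e0 / 2 + e0 / 2"
      using \<tau>(5) C B by (intro add_mono) (auto simp: e_def field_simps)
    finally show "?g \<bullet> W x - \<epsilon> * norm ?g - ?d / K \<le> 0 + e0" by simp
  qed
  then have "K * (?g \<bullet> W x - \<epsilon> * norm ?g - ?d / K) \<le> 0" using K by (simp add: mult_le_0_iff)
  then show "?d + K * (\<epsilon> * norm ?g - W x \<bullet> ?g) \<ge> 0" using K by (simp add: algebra_simps inner_commute)
qed

theorem val_viscosity_solution:
  assumes K: "0 < K"
  shows "viscosity_solution_Cauchy (\<lambda>q x. K * (\<epsilon> * norm q - W x \<bullet> q)) (\<lambda>x. p \<bullet> x) (\<lambda>(x, t). val p x (K * t))"
  unfolding viscosity_solution_Cauchy_def
  using val_continuous[of K p] val_subsolution[OF K] val_supersolution[OF K] K val_0 by auto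

end

section \<open>Comparison principle\<close>

lemma C1_test_function_add:
  assumes "C1_test_function \<phi> g d" "C1_test_function \<phi>' g' d'"
  shows "C1_test_function (\<lambda>z. \<phi> z + \<phi>' z) (\<lambda>z. g z + g' z) (\<lambda>z. d z + d' z)"
proof -
  have "((\<lambda>z. \<phi> z + \<phi>' z) has_derivative (\<lambda>(h, k). (g z + g' z) \<bullet> h + (d z + d' z) * k)) (at z)"
    if "z \<in> UNIV \<times> {0<..}" for z
  proof -
    have "((\<lambda>z. \<phi> z + \<phi>' z) has_derivative (\<lambda>y. (case y of (h, k) \<Rightarrow> g z \<bullet> h + d z * k)
        + (case y of (h, k) \<Rightarrow> g' z \<bullet> h + d' z * k))) (at z)"
      using assms that by (intro has_derivative_add) (auto simp: C1_test_function_def)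
    then show ?thesis
      by (rule has_derivative_eq_rhs) (auto simp: algebra_simps inner_add_left)
  qed
  then show ?thesis using assms unfolding C1_test_function_def by (auto intro: continuous_on_add)
qed

lemma C1_test_function_quadratic:
  fixes z0 :: "'a::euclidean_space \<times> real"
  shows "C1_test_function (\<lambda>z. c * (norm (z - z0))\<^sup>2) (\<lambda>z. (2 * c) *\<^sub>R (fst z - fst z0)) (\<lambda>z. 2 * c * (snd z - snd z0))"
proof -
  have "((\<lambda>z. c * (norm (z - z0))\<^sup>2) has_derivative
      (\<lambda>(h, k). ((2 * c) *\<^sub>R (fst z - fst z0)) \<bullet> h + 2 * c * (snd z - snd z0) * k)) (at z)" for z
    unfolding power2_norm_eq_inner
    by (auto intro!: derivative_eq_intros simp: inner_prod_def algebra_simps inner_commute fun_eq_iff)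
  then show ?thesis unfolding C1_test_function_def by (auto intro!: continuous_intros)
qed

text \<open>The square root is a smooth substitute for the distance to \<open>x0\<close> and its
  gradient has norm at most 1. For nonnegative \<open>k\<close> and \<open>a\<close> the time
  derivative thus exceeds \<open>a\<close> times the norm of the spatial gradient by
  \<delta>.\<close>

lemma C1_test_function_cone:
  fixes x0 :: "'a::euclidean_space" and k a b \<delta> :: real
  defines "E \<equiv> \<lambda>z. exp (k * (a * snd z + sqrt (1 + (norm (fst z - x0))\<^sup>2) - b))"
  shows "C1_test_function (\<lambda>z. E z + \<delta> * snd z)
     (\<lambda>z. (k * E z / sqrt (1 + (norm (fst z - x0))\<^sup>2)) *\<^sub>R (fst z - x0)) (\<lambda>z. k * a * E z + \<delta>)"
proof -
  have p: "0 < 1 + (norm (fst z - x0))\<^sup>2" for z :: "'a \<times> real" by (simp add: add_pos_nonneg)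
  have q: "((\<lambda>z. (norm (fst z - x0))\<^sup>2) has_derivative (\<lambda>h. 2 * ((fst z - x0) \<bullet> fst h))) (at z)" for z :: "'a \<times> real"
    unfolding power2_norm_eq_inner
    by (auto intro!: derivative_eq_intros simp: algebra_simps inner_commute fun_eq_iff)
  let ?j = "\<lambda>z::'a \<times> real. sqrt (1 + (norm (fst z - x0))\<^sup>2)"
  have q': "((\<lambda>z. 1 + (norm (fst z - x0))\<^sup>2) has_derivative (\<lambda>h. 0 + 2 * ((fst z - x0) \<bullet> fst h))) (at z)" for z :: "'a \<times> real"
    by (intro has_derivative_add has_derivative_const q)
  have s: "(?j has_derivative (\<lambda>h. (0 + 2 * ((fst z - x0) \<bullet> fst h)) * (inverse (?j z) / 2))) (at z)" for z
    by (rule has_derivative_real_sqrt[OF p q'])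
  have e: "((\<lambda>z. k * (a * snd z + ?j z - b)) has_derivative
      (\<lambda>h. k * (a * snd h + (0 + 2 * ((fst z - x0) \<bullet> fst h)) * (inverse (?j z) / 2) - 0))) (at z)" for z
    by (intro has_derivative_mult_right has_derivative_diff has_derivative_add has_derivative_snd
        has_derivative_ident has_derivative_const s)
  have f: "((\<lambda>z. E z + \<delta> * snd z) has_derivative
      (\<lambda>h. k * (a * snd h + (0 + 2 * ((fst z - x0) \<bullet> fst h)) * (inverse (?j z) / 2) - 0) * E z + \<delta> * snd h)) (at z)" for z
    unfolding E_def
    by (intro has_derivative_add has_derivative_exp[OF e] has_derivative_mult_right has_derivative_snd has_derivative_ident)
  have "((\<lambda>z. E z + \<delta> * snd z) has_derivative
      (\<lambda>(h, l). ((k * E z / ?j z) *\<^sub>R (fst z - x0)) \<bullet> h + (k * a * E z + \<delta>) * l)) (at z)" for z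
  proof (rule has_derivative_eq_rhs[OF f])
    have ring: "k * (a * l + (0 + 2 * v) * (i * inverse 2) - 0) * e + \<delta> * l = k * e * i * v + (k * a * e + \<delta>) * l"
      for l v i e :: real by (simp add: algebra_simps)
    show "(\<lambda>h. k * (a * snd h + (0 + 2 * ((fst z - x0) \<bullet> fst h)) * (inverse (?j z) / 2) - 0) * E z + \<delta> * snd h)
      = (\<lambda>(h, l). ((k * E z / ?j z) *\<^sub>R (fst z - x0)) \<bullet> h + (k * a * E z + \<delta>) * l)"
      unfolding case_prod_unfold inner_scaleR_left divide_inverse by (rule ext) (rule ring)
  qed
  moreover have "sqrt (1 + (norm (fst z - x0))\<^sup>2) \<noteq> 0" for z :: "'a \<times> real" using p[of z] by simp
  ultimately show ?thesis unfolding C1_test_function_def E_def by (auto intro!: continuous_intros)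
qed

text \<open>Doubling of variables on a compact cylinder. Finite propagation speed \<open>A\<close>
  replaces growth conditions: the barrier \<psi> is a strict supersolution of the eikonal equation
  with speed \<open>A\<close>, small at the point of interest and larger than any value of u - v on
  the lateral and final boundary, so that the maximum is interior.\<close>

theorem viscosity_comparison:
  fixes u v :: "'a::euclidean_space \<times> real \<Rightarrow> real" and H :: "'a \<Rightarrow> 'a \<Rightarrow> real"
  assumes A: "0 < A" and B: "0 \<le> B"
    and H1: "\<And>q q' x. \<bar>H q x - H q' x\<bar> \<le> A * norm (q - q')"
    and H2: "\<And>q x y. \<bar>H q x - H q y\<bar> \<le> B * norm (x - y) * norm q"
    and u: "continuous_on (UNIV \<times> {0..}) u" "viscosity_subsolution H u"
    and v: "continuous_on (UNIV \<times> {0..}) v" "viscosity_supersolution H v"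
    and init: "\<And>x. u (x, 0) \<le> v (x, 0)"
    and T0: "0 \<le> T0"
  shows "u (x0, T0) \<le> v (x0, T0)"
proof (rule ccontr)
  assume neg: "\<not> ?thesis"
  \<comment> \<open>At \<open>(x0, T0)\<close> the barrier uses up two thirds of the gap, one for
    the exponential and one for \<delta> times the time; the last third keeps the maximum
    positive.\<close>
  define \<sigma> where "\<sigma> = (u (x0, T0) - v (x0, T0)) / 3"
  have \<sigma>: "0 < \<sigma>" using neg by (simp add: \<sigma>_def)
  define T where "T = T0 + 1"
  \<comment> \<open>The exponent of the barrier will be -k \<beta> at \<open>(x0, T0)\<close>, and
    at least k \<beta> both one time unit later, where A = 2 \<beta> has been gained, and at
    distance \<open>R\<close>. A large \<open>k\<close> then separates the two.\<close>
  define \<beta> where "\<beta> = A / 2"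
  have \<beta>: "0 < \<beta>" using A by (simp add: \<beta>_def)
  define R where "R = A * T0 + 2 * \<beta> + 1"
  have R: "0 < R" using A T0 \<beta> by (simp add: R_def add_nonneg_pos)
  define Q where "Q = cball x0 R \<times> {0..T}"
  have Q: "compact Q" unfolding Q_def by (intro compact_Times) auto
  have Qsub: "Q \<subseteq> UNIV \<times> {0..}" by (auto simp: Q_def)
  have uQ: "continuous_on Q u" and vQ: "continuous_on Q v"
    using u(1) v(1) Qsub by (auto intro: continuous_on_subset)
  obtain N1 where N1: "\<And>z. z \<in> Q \<Longrightarrow> \<bar>u z\<bar> \<le> N1"
    using compact_imp_bounded[OF compact_continuous_image[OF uQ Q]] by (auto simp: bounded_iff)
  obtain N2 where N2: "\<And>z. z \<in> Q \<Longrightarrow> \<bar>v z\<bar> \<le> N2"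
    using compact_imp_bounded[OF compact_continuous_image[OF vQ Q]] by (auto simp: bounded_iff)
  define N where "N = \<bar>N1\<bar> + \<bar>N2\<bar>"
  have N: "u z - v z' \<le> N" if "z \<in> Q" "z' \<in> Q" for z z' using N1[OF that(1)] N2[OF that(2)] by (simp add: N_def)
  define k where "k = (1 / \<sigma> + N) / \<beta>"
  have k: "0 < k" using \<sigma> \<beta> by (simp add: k_def N_def add_pos_nonneg)
  have kb: "k * \<beta> = 1 / \<sigma> + N" using \<beta> by (simp add: k_def)
  have N0: "0 \<le> N" and "0 < 1 / \<sigma>" using \<sigma> by (auto simp: N_def)
  then have exp_kb: "1 / \<sigma> \<le> exp (k * \<beta>)" "N \<le> exp (k * \<beta>)"
    using exp_ge_add_one_self[of "k * \<beta>"] kb by linarith+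
  define \<delta> where "\<delta> = \<sigma> / (T0 + 1)"
  have \<delta>: "0 < \<delta>" using \<sigma> T0 by (simp add: \<delta>_def)
  define j where "j z = sqrt (1 + (norm (fst z - x0))\<^sup>2)" for z :: "'a \<times> real"
  define E where "E z = exp (k * (A * snd z + j z - (A * T0 + 1 + \<beta>)))" for z
  define \<psi> where "\<psi> z = E z + \<delta> * snd z" for z
  define g\<psi> where "g\<psi> z = (k * E z / j z) *\<^sub>R (fst z - x0)" for z
  define d\<psi> where "d\<psi> z = k * A * E z + \<delta>" for z
  have \<psi>_C1: "C1_test_function \<psi> g\<psi> d\<psi>"
    using C1_test_function_cone[of k A x0 "A * T0 + 1 + \<beta>" \<delta>]
    unfolding \<psi>_def[abs_def] g\<psi>_def[abs_def] d\<psi>_def[abs_def] E_def j_def .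
  have j1: "1 \<le> j z" and jn: "norm (fst z - x0) \<le> j z" for z
    unfolding j_def by (auto intro: real_le_rsqrt)
  have \<psi>_strict: "A * norm (g\<psi> z) + \<delta> \<le> d\<psi> z" for z
  proof -
    have "norm (g\<psi> z) = k * E z * (norm (fst z - x0) / j z)"
      using k j1[of z] by (simp add: g\<psi>_def E_def)
    also have "\<dots> \<le> k * E z * 1"
      using k j1[of z] jn[of z] by (intro mult_left_mono) (auto simp: E_def)
    finally have "A * norm (g\<psi> z) \<le> A * (k * E z)" using A by (intro mult_left_mono) auto
    then show ?thesis by (simp add: d\<psi>_def ac_simps)
  qed
  have \<psi>_nonneg: "0 \<le> \<psi> z" if "z \<in> Q" for z
    using that \<delta> by (auto simp: \<psi>_def E_def Q_def intro!: add_nonneg_nonneg)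
  have \<psi>_cont: "continuous_on Q \<psi>"
    unfolding \<psi>_def[abs_def] E_def j_def by (intro continuous_intros)
  have \<psi>_top: "\<psi> (x0, T0) \<le> 2 * \<sigma>"
  proof -
    have "E (x0, T0) = 1 / exp (k * \<beta>)" by (simp add: E_def j_def exp_minus inverse_eq_divide)
    also have "\<dots> \<le> \<sigma>" using exp_kb(1) \<sigma> by (simp add: field_simps)
    finally have "E (x0, T0) \<le> \<sigma>" .
    moreover have "\<delta> * T0 \<le> \<sigma>" using \<sigma> T0 by (simp add: \<delta>_def field_simps)
    ultimately show ?thesis by (simp add: \<psi>_def)
  qed
  have \<psi>_boundary: "N \<le> \<psi> z" if z: "z \<in> Q" "snd z = T \<or> norm (fst z - x0) = R" for z
  proof -
    have "\<beta> \<le> A * snd z + j z - (A * T0 + 1 + \<beta>)"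
    proof (cases "snd z = T")
      case True
      then show ?thesis using j1[of z] by (simp add: T_def \<beta>_def algebra_simps)
    next
      case False
      then have "R \<le> j z" using z jn[of z] by simp
      moreover have "0 \<le> A * snd z" using z A by (auto simp: Q_def)
      ultimately show ?thesis by (simp add: R_def)
    qed
    then have "exp (k * \<beta>) \<le> E z" using k by (simp add: E_def)
    moreover have "0 \<le> \<delta> * snd z" using z \<delta> by (auto simp: Q_def)
    ultimately show ?thesis using exp_kb(2) by (simp add: \<psi>_def)
  qed
  define \<Phi> where "\<Phi> n w = u (fst w) - v (snd w) - \<psi> (fst w) - real n * (norm (fst w - snd w))\<^sup>2" for n :: nat and w
  have top: "(x0, T0) \<in> Q" using R T0 by (simp add: Q_def T_def)
  have "\<exists>w\<in>Q \<times> Q. \<forall>w'\<in>Q \<times> Q. \<Phi> n w' \<le> \<Phi> n w" for n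
  proof (rule continuous_attains_sup)
    show "compact (Q \<times> Q)" using Q by (intro compact_Times)
    show "Q \<times> Q \<noteq> {}" using top by auto
    show "continuous_on (Q \<times> Q) (\<Phi> n)" unfolding \<Phi>_def[abs_def]
      by (intro continuous_intros continuous_on_compose2[OF uQ] continuous_on_compose2[OF vQ]
          continuous_on_compose2[OF \<psi>_cont]) auto
  qed
  then obtain w where w: "\<And>n. w n \<in> Q \<times> Q" and wmax: "\<And>n w'. w' \<in> Q \<times> Q \<Longrightarrow> \<Phi> n w' \<le> \<Phi> n (w n)"
    by metis
  define z where "z n = fst (w n)" for n
  define z' where "z' n = snd (w n)" for n
  have zQ: "z n \<in> Q" and z'Q: "z' n \<in> Q" for n using w[of n] by (auto simp: z_def z'_def mem_Times_iff)
  define D where "D n = real n * (norm (z n - z' n))\<^sup>2" for n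
  have D0: "0 \<le> D n" for n by (simp add: D_def)
  have max: "u a - v b - \<psi> a - real n * (norm (a - b))\<^sup>2 \<le> u (z n) - v (z' n) - \<psi> (z n) - D n"
    if "a \<in> Q" "b \<in> Q" for a b n
    using wmax[of "(a, b)" n] that by (simp add: \<Phi>_def z_def z'_def D_def)
  have low: "\<sigma> \<le> u (z n) - v (z' n) - \<psi> (z n) - D n" for n
    using max[OF top top, of n] \<psi>_top \<sigma> by (simp add: \<sigma>_def field_simps)
  have Dle: "D n \<le> N" for n using low[of n] \<psi>_nonneg[OF zQ[of n]] N[OF zQ[of n] z'Q[of n]] \<sigma> by linarith
  have "seq_compact (Q \<times> Q)" using Q by (intro compact_imp_seq_compact compact_Times)
  then obtain lw r where lw: "lw \<in> Q \<times> Q" and r: "strict_mono r" and lim: "(w \<circ> r) \<longlonglongrightarrow> lw"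
    using w by (auto elim!: seq_compactE[of _ w])
  have limz: "(\<lambda>n. z (r n)) \<longlonglongrightarrow> fst lw" and limz': "(\<lambda>n. z' (r n)) \<longlonglongrightarrow> snd lw"
    using lim by (auto simp: z_def z'_def o_def intro: tendsto_fst tendsto_snd)
  have rinf: "filterlim (\<lambda>n. real (r n)) at_top sequentially"
    using filterlim_subseq[OF r] filterlim_real_sequentially by (rule filterlim_compose[rotated])
  have "(\<lambda>n. (norm (z (r n) - z' (r n)))\<^sup>2) \<longlonglongrightarrow> 0"
  proof (rule tendsto_sandwich[of "\<lambda>_. 0"])
    show "(\<lambda>n. N / real (r n)) \<longlonglongrightarrow> 0" using rinf by (intro tendsto_divide_0[OF tendsto_const] filterlim_at_top_imp_at_infinity)
    show "\<forall>\<^sub>F n in sequentially. (norm (z (r n) - z' (r n)))\<^sup>2 \<le> N / real (r n)"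
    proof (rule eventually_mono[OF filterlim_at_top_dense[THEN iffD1, OF rinf, rule_format, of 0]])
      fix n assume "0 < real (r n)"
      then show "(norm (z (r n) - z' (r n)))\<^sup>2 \<le> N / real (r n)"
        using Dle[of "r n"] by (simp add: D_def field_simps)
    qed
  qed auto
  moreover have "(\<lambda>n. (norm (z (r n) - z' (r n)))\<^sup>2) \<longlonglongrightarrow> (norm (fst lw - snd lw))\<^sup>2"
    by (intro tendsto_intros limz limz')
  ultimately have "(norm (fst lw - snd lw))\<^sup>2 = 0" using LIMSEQ_unique by blast
  then have eq: "snd lw = fst lw" by simp
  define l where "l = fst lw"
  have lQ: "l \<in> Q" using lw by (auto simp: l_def)
  have limz: "(\<lambda>n. z (r n)) \<longlonglongrightarrow> l" and limz': "(\<lambda>n. z' (r n)) \<longlonglongrightarrow> l" using limz limz' eq by (auto simp: l_def)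
  have limS: "(\<lambda>n. u (z (r n)) - v (z' (r n)) - \<psi> (z (r n))) \<longlonglongrightarrow> u l - v l - \<psi> l"
    by (intro tendsto_intros continuous_on_tendsto_compose[OF uQ limz lQ] continuous_on_tendsto_compose[OF vQ limz' lQ]
        continuous_on_tendsto_compose[OF \<psi>_cont limz lQ] always_eventually allI zQ z'Q)
  \<comment> \<open>Comparing the maximum with the diagonal pair \<open>(l, l)\<close> bounds the
    penalty by a difference that tends to 0.\<close>
  have Dlim: "(\<lambda>n. D (r n)) \<longlonglongrightarrow> 0"
  proof (rule tendsto_sandwich[of "\<lambda>_. 0"])
    show "(\<lambda>n. u (z (r n)) - v (z' (r n)) - \<psi> (z (r n)) - (u l - v l - \<psi> l)) \<longlonglongrightarrow> 0"
      using tendsto_diff[OF limS tendsto_const[of "u l - v l - \<psi> l"]] by simp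
    show "\<forall>\<^sub>F n in sequentially. D (r n) \<le> u (z (r n)) - v (z' (r n)) - \<psi> (z (r n)) - (u l - v l - \<psi> l)"
    proof (intro always_eventually allI)
      fix n show "D (r n) \<le> u (z (r n)) - v (z' (r n)) - \<psi> (z (r n)) - (u l - v l - \<psi> l)"
        using max[OF lQ lQ, of "r n"] by simp
    qed
  qed (auto simp: D0)
  have pos: "\<sigma> \<le> u l - v l - \<psi> l"
  proof (rule tendsto_lowerbound[OF limS])
    show "\<forall>\<^sub>F n in sequentially. \<sigma> \<le> u (z (r n)) - v (z' (r n)) - \<psi> (z (r n))"
    proof (intro always_eventually allI)
      fix n show "\<sigma> \<le> u (z (r n)) - v (z' (r n)) - \<psi> (z (r n))" using low[of "r n"] D0[of "r n"] by linarith
    qed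
  qed simp
  define I where "I = ball x0 R \<times> {0<..<T}"
  have "l \<in> I"
  proof -
    have "u l - v l \<le> N" using N lQ by blast
    then have "\<not> N \<le> \<psi> l" using pos \<sigma> by simp
    then have b: "snd l \<noteq> T" "norm (fst l - x0) \<noteq> R" using \<psi>_boundary[OF lQ] by auto
    have "snd l \<noteq> 0"
    proof
      assume "snd l = 0"
      then have "u l \<le> v l" using init[of "fst l"] by (metis prod.collapse)
      then show False using pos \<psi>_nonneg[OF lQ] \<sigma> by simp
    qed
    then show ?thesis using b lQ by (auto simp: I_def Q_def mem_Times_iff dist_norm norm_minus_commute)
  qed
  have I: "open I" "I \<subseteq> Q" by (auto simp: I_def Q_def intro: open_Times)
  \<comment> \<open>In the difference of the two viscosity inequalities the time derivatives of the
    penalty cancel. The gradient of \<psi> costs at most \<open>A\<close> times its norm, which the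
    time derivative of \<psi> pays for with \<delta> to spare; the dependence of \<open>H\<close> on
    x costs a multiple of the penalty.\<close>
  have key: "\<delta> \<le> 2 * B * D n" if zI: "z n \<in> I" and z'I: "z' n \<in> I" for n
  proof -
    define x where "x = fst (z n)"
    define t where "t = snd (z n)"
    define y where "y = fst (z' n)"
    define s where "s = snd (z' n)"
    have zn: "z n = (x, t)" "z' n = (y, s)" by (auto simp: x_def t_def y_def s_def)
    have t: "0 < t" and s: "0 < s" using zI z'I unfolding zn by (auto simp: I_def)
    let ?q = "(2 * real n) *\<^sub>R (x - y)"
    let ?\<tau> = "2 * real n * (t - s)"
    have evz: "\<forall>\<^sub>F a in nhds (x, t). a \<in> Q" and evz': "\<forall>\<^sub>F a in nhds (y, s). a \<in> Q"
      using zI z'I I unfolding zn by (auto simp: eventually_nhds)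
    have C1: "C1_test_function (\<lambda>a. \<psi> a + real n * (norm (a - (y, s)))\<^sup>2)
      (\<lambda>a. g\<psi> a + (2 * real n) *\<^sub>R (fst a - fst (y, s))) (\<lambda>a. d\<psi> a + 2 * real n * (snd a - snd (y, s)))"
      by (intro C1_test_function_add \<psi>_C1 C1_test_function_quadratic)
    have touch: "\<forall>\<^sub>F a in nhds (x, t). u a - (\<psi> a + real n * (norm (a - (y, s)))\<^sup>2)
        \<le> u (x, t) - (\<psi> (x, t) + real n * (norm ((x, t) - (y, s)))\<^sup>2)"
      using evz
    proof (rule eventually_mono)
      fix a assume "a \<in> Q"
      from max[OF this z'Q[of n], of n] show "u a - (\<psi> a + real n * (norm (a - (y, s)))\<^sup>2)
        \<le> u (x, t) - (\<psi> (x, t) + real n * (norm ((x, t) - (y, s)))\<^sup>2)"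
        unfolding zn D_def by simp
    qed
    have sub: "d\<psi> (x, t) + ?\<tau> + H (g\<psi> (x, t) + ?q) x \<le> 0"
      using u(2)[unfolded viscosity_subsolution_def, rule_format, OF conjI, OF C1 conjI, OF t touch] by simp
    have C1': "C1_test_function (\<lambda>a. (- real n) * (norm (a - (x, t)))\<^sup>2)
      (\<lambda>a. (2 * (- real n)) *\<^sub>R (fst a - fst (x, t))) (\<lambda>a. 2 * (- real n) * (snd a - snd (x, t)))"
      by (rule C1_test_function_quadratic)
    have touch': "\<forall>\<^sub>F a in nhds (y, s). v a - (- real n) * (norm (a - (x, t)))\<^sup>2
        \<ge> v (y, s) - (- real n) * (norm ((y, s) - (x, t)))\<^sup>2"
      using evz'
    proof (rule eventually_mono)
      fix a assume "a \<in> Q"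
      from max[OF zQ[of n] this, of n] show "v a - (- real n) * (norm (a - (x, t)))\<^sup>2
        \<ge> v (y, s) - (- real n) * (norm ((y, s) - (x, t)))\<^sup>2"
        unfolding zn D_def norm_minus_commute[of a "(x, t)"] norm_minus_commute[of "(y, s)" "(x, t)"] by linarith
    qed
    have "2 * (- real n) * (s - t) + H ((2 * (- real n)) *\<^sub>R (y - x)) y \<ge> 0"
      using v(2)[unfolded viscosity_supersolution_def, rule_format, OF conjI, OF C1' conjI, OF s touch'] by simp
    moreover have "(2 * (- real n)) *\<^sub>R (y - x) = ?q" by (simp add: algebra_simps)
    ultimately have super: "?\<tau> + H ?q y \<ge> 0" by (simp add: algebra_simps)
    have "H ?q x - H (g\<psi> (x, t) + ?q) x \<le> A * norm (g\<psi> (x, t))"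
      using H1[of ?q x "g\<psi> (x, t) + ?q"] by (simp add: abs_le_iff)
    then have "\<delta> \<le> H ?q y - H ?q x" using sub super \<psi>_strict[of "(x, t)"] by linarith
    also have "\<dots> \<le> B * norm (y - x) * norm ?q" using H2[of ?q y x] by (simp add: abs_le_iff)
    also have "\<dots> = 2 * B * (real n * (norm (x - y))\<^sup>2)"
      by (simp add: power2_eq_square norm_minus_commute)
    also have "\<dots> \<le> 2 * B * D n"
    proof -
      have "norm (x - y) \<le> norm (z n - z' n)" unfolding zn by (simp add: norm_fst_le)
      then show ?thesis unfolding D_def using B by (intro mult_left_mono power_mono) auto
    qed
    finally show ?thesis .
  qed
  have "\<forall>\<^sub>F n in sequentially. z (r n) \<in> I \<and> z' (r n) \<in> I"
    using topological_tendstoD[OF limz I(1) \<open>l \<in> I\<close>] topological_tendstoD[OF limz' I(1) \<open>l \<in> I\<close>]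
    by (rule eventually_conj)
  then have "\<forall>\<^sub>F n in sequentially. \<delta> \<le> 2 * B * D (r n)" by (rule eventually_mono) (auto intro: key)
  moreover have "(\<lambda>n. 2 * B * D (r n)) \<longlonglongrightarrow> 2 * B * 0" by (intro tendsto_intros Dlim)
  ultimately have "\<delta> \<le> 2 * B * 0" by (intro tendsto_lowerbound) auto
  then show False using \<delta> by simp
qed

section \<open>Controllability of the ABC flow\<close>

lemma ABC_flow_nth [simp]:
  "ABC_flow v $ 1 = sin (v$3) + cos (v$2)"
  "ABC_flow v $ 2 = sin (v$1) + cos (v$3)"
  "ABC_flow v $ 3 = sin (v$2) + cos (v$1)"
  by (simp_all add: ABC_flow_def)

lemma norm_le_sum_3: "norm (v::real^3) \<le> \<bar>v$1\<bar> + \<bar>v$2\<bar> + \<bar>v$3\<bar>"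
  using norm_le_l1_cart[of v] by (simp add: sum_3)

lemma sin_lipschitz: "\<bar>sin x - sin y\<bar> \<le> \<bar>x - y\<bar>" for x y :: real
proof -
  have "\<bar>sin x - sin y\<bar> = 2 * (\<bar>sin ((x - y) / 2)\<bar> * \<bar>cos ((x + y) / 2)\<bar>)"
    by (simp add: sin_diff_sin abs_mult)
  also have "\<dots> \<le> 2 * (\<bar>(x - y) / 2\<bar> * 1)"
    by (intro mult_left_mono mult_mono abs_sin_x_le_abs_x) auto
  finally show ?thesis by simp
qed

lemma cos_lipschitz: "\<bar>cos x - cos y\<bar> \<le> \<bar>x - y\<bar>" for x y :: real
  using sin_lipschitz[of "x + pi/2" "y + pi/2"] by (simp add: sin_add)

lemma ABC_flow_bound: "norm (ABC_flow v) \<le> 6"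
proof -
  have "\<bar>sin a + cos b\<bar> \<le> 2" for a b :: real
    using abs_sin_le_one[of a] abs_cos_le_one[of b] by linarith
  from this[of "v$3" "v$2"] this[of "v$1" "v$3"] this[of "v$2" "v$1"]
  show ?thesis using norm_le_sum_3[of "ABC_flow v"] by simp
qed

lemma ABC_flow_lipschitz: "norm (ABC_flow v - ABC_flow w) \<le> 6 * norm (v - w)"
proof -
  have d: "\<bar>sin a + cos b - (sin a' + cos b')\<bar> \<le> \<bar>a - a'\<bar> + \<bar>b - b'\<bar>" for a b a' b' :: real
    using sin_lipschitz[of a a'] cos_lipschitz[of b b'] by linarith
  have c: "\<bar>v$i - w$i\<bar> \<le> norm (v - w)" for i using component_le_norm_cart[of "v - w" i] by simp
  show ?thesis
    using norm_le_sum_3[of "ABC_flow v - ABC_flow w"] c[of 1] c[of 2] c[of 3]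
      d[of "v$3" "v$2" "w$3" "w$2"] d[of "v$1" "v$3" "w$1" "w$3"] d[of "v$2" "v$1" "w$2" "w$1"]
    unfolding vector_minus_component ABC_flow_nth by linarith
qed

section \<open>Reachability modulo periods and rounded shears\<close>

definition period_lattice :: "(real^3) set"
  where "period_lattice = {l. \<forall>i. \<exists>m::int. l$i = 2 * pi * of_int m}"

lemma period_lattice_0 [simp]: "0 \<in> period_lattice"
  by (auto simp: period_lattice_def intro: exI[of _ 0])

lemma period_lattice_add: "l \<in> period_lattice \<Longrightarrow> l' \<in> period_lattice \<Longrightarrow> l + l' \<in> period_lattice"
  unfolding period_lattice_def mem_Collect_eq vector_add_component by (metis distrib_left of_int_add)

lemma sin_cos_period: "sin (x + 2 * pi * of_int m) = sin x" "cos (x + 2 * pi * of_int m) = cos x"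
  by (simp_all add: sin_add cos_add)

lemma ABC_flow_period:
  assumes "l \<in> period_lattice" shows "ABC_flow (v + l) = ABC_flow v"
proof -
  obtain m where "\<And>i. l$i = 2 * pi * of_int (m i :: int)"
    using assms unfolding period_lattice_def by simp metis
  then show ?thesis by (simp add: vec_eq_iff forall_3 sin_cos_period)
qed

lemma reach_period:
  assumes "l \<in> period_lattice" "reach ABC_flow \<epsilon> x y t"
  shows "reach ABC_flow \<epsilon> (x + l) (y + l) t"
  using reach_isometry[of "\<lambda>v. v" ABC_flow l ABC_flow, OF linear_ident _ _ assms(2)] ABC_flow_period[OF assms(1)] by simp

lemma drift_ABC: "0 < \<epsilon> \<Longrightarrow> drift ABC_flow \<epsilon> 6 6"
  by unfold_locales (auto simp: ABC_flow_bound ABC_flow_lipschitz)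

definition leads :: "real \<Rightarrow> real^3 \<Rightarrow> real^3 \<Rightarrow> bool"
  where "leads \<epsilon> x y \<longleftrightarrow> (\<exists>t. \<exists>l\<in>period_lattice. reach ABC_flow \<epsilon> x (y + l) t)"

lemma leads_trans: 
  assumes "leads \<epsilon> x y" "leads \<epsilon> y z" shows "leads \<epsilon> x z"
proof -
  obtain t l where l: "l \<in> period_lattice" "reach ABC_flow \<epsilon> x (y + l) t" using assms(1) by (auto simp: leads_def)
  obtain s k where k: "k \<in> period_lattice" "reach ABC_flow \<epsilon> y (z + k) s" using assms(2) by (auto simp: leads_def)
  have "reach ABC_flow \<epsilon> x (z + (k + l)) (t + s)"
    using reach_trans[OF l(2) reach_period[OF l(1) k(2)]] by (simp add: add.assoc)
  then show ?thesis using period_lattice_add[OF k(1) l(1)] by (auto simp: leads_def)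
qed

lemma leads_reach: "reach ABC_flow \<epsilon> x y t \<Longrightarrow> leads \<epsilon> x y"
  unfolding leads_def by (metis add.right_neutral period_lattice_0)

text \<open>A map that is injective on a finite quotient is recurrent; this takes the role of volume
  preservation.\<close>
lemma finite_quotient_recurrent:
  fixes f :: "'a \<Rightarrow> 'a" and r :: "'a \<Rightarrow> 'b"
  assumes fin: "finite (range r)" and inj: "\<And>a b. r (f a) = r (f b) \<Longrightarrow> r a = r b"
  shows "\<exists>n>0. r ((f ^^ n) a) = r a"
proof -
  have "\<not> inj (\<lambda>n. r ((f ^^ n) a))"
    using finite_subset[OF _ fin, of "range (\<lambda>n. r ((f ^^ n) a))"] finite_imageD[of "\<lambda>n. r ((f ^^ n) a)" UNIV]
    by auto
  then obtain m n where "r ((f ^^ m) a) = r ((f ^^ n) a)" "m < n"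
    unfolding inj_def by (metis linorder_neqE_nat)
  \<comment> \<open>Injectivity modulo \<open>r\<close> cancels the first \<open>m\<close> steps of
    the repetition and leaves a return to the start.\<close>
  moreover have "r ((f ^^ m) a) = r ((f ^^ (m + k)) a) \<Longrightarrow> r a = r ((f ^^ k) a)" for m k
    by (induction m) (auto dest: inj)
  ultimately have "r a = r ((f ^^ (n - m)) a)" by (metis add_diff_inverse_nat less_imp_not_less)
  then show ?thesis using \<open>m < n\<close> by (metis zero_less_diff)
qed

text \<open>Each component of the flow is independent of the coordinate that it moves, so the rounded
  shears remain injective on the lattice.\<close>
fun lattice_step :: "real \<Rightarrow> real \<Rightarrow> int \<times> int \<times> int \<Rightarrow> int \<times> int \<times> int"
  where "lattice_step h \<delta> (i, j, k) =
    (let i' = i + round (h * (sin (\<delta> * of_int k) + cos (\<delta> * of_int j)) / \<delta>);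
         j' = j + round (h * (sin (\<delta> * of_int i') + cos (\<delta> * of_int k)) / \<delta>);
         k' = k + round (h * (sin (\<delta> * of_int j') + cos (\<delta> * of_int i')) / \<delta>)
     in (i', j', k'))"

fun lattice_point :: "real \<Rightarrow> int \<times> int \<times> int \<Rightarrow> real^3"
  where "lattice_point \<delta> (i, j, k) = vector [\<delta> * of_int i, \<delta> * of_int j, \<delta> * of_int k]"

fun reduce :: "int \<Rightarrow> int \<times> int \<times> int \<Rightarrow> int \<times> int \<times> int"
  where "reduce N (i, j, k) = (i mod N, j mod N, k mod N)"

text \<open>The three shears are undone in reverse order. The predecessor so obtained lets a polygon
  end at an arbitrary prescribed point in \<open>ABC_controllable\<close>.\<close>

lemma lattice_step_surj: "\<exists>a. lattice_step h \<delta> a = b"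
proof -
  obtain i' j' k' where b: "b = (i', j', k')" by (cases b)
  define k where "k = k' - round (h * (sin (\<delta> * of_int j') + cos (\<delta> * of_int i')) / \<delta>)"
  define j where "j = j' - round (h * (sin (\<delta> * of_int i') + cos (\<delta> * of_int k)) / \<delta>)"
  define i where "i = i' - round (h * (sin (\<delta> * of_int k) + cos (\<delta> * of_int j)) / \<delta>)"
  have "i + round (h * (sin (\<delta> * of_int k) + cos (\<delta> * of_int j)) / \<delta>) = i'" by (simp add: i_def)
  moreover have "j + round (h * (sin (\<delta> * of_int i') + cos (\<delta> * of_int k)) / \<delta>) = j'" by (simp add: j_def)
  moreover have "k + round (h * (sin (\<delta> * of_int j') + cos (\<delta> * of_int i')) / \<delta>) = k'" by (simp add: k_def)
  ultimately have "lattice_step h \<delta> (i, j, k) = b" by (simp only: b lattice_step.simps Let_def)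
  then show ?thesis by blast
qed

lemma lattice_coordinate_mod:
  fixes N :: int
  assumes "0 < N" "\<delta> = 2 * pi / of_int N" "a mod N = b mod N"
  shows "\<exists>m::int. \<delta> * of_int a = \<delta> * of_int b + 2 * pi * of_int m"
proof -
  obtain m where "a = b + N * m" using assms(3) by (metis mod_eqE mult.commute)
  then show ?thesis using assms(1,2) by (intro exI[of _ m]) (simp add: field_simps)
qed

lemma sin_cos_lattice_mod:
  fixes N :: int
  assumes "0 < N" "\<delta> = 2 * pi / of_int N" "a mod N = b mod N"
  shows "sin (\<delta> * of_int a) = sin (\<delta> * of_int b)" "cos (\<delta> * of_int a) = cos (\<delta> * of_int b)"
  using lattice_coordinate_mod[OF assms] by (auto simp: sin_cos_period)

text \<open>As \<delta> N = 2 pi, the rounded increments depend on residues only. Cancelling starts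
  with the last shear, since each earlier increment involves coordinates that must be recovered
  before it.\<close>

lemma lattice_step_inj_mod:
  assumes N: "0 < N" "\<delta> = 2 * pi / of_int N"
    and "reduce N (lattice_step h \<delta> a) = reduce N (lattice_step h \<delta> b)"
  shows "reduce N a = reduce N b"
proof -
  obtain i1 j1 k1 i2 j2 k2 where ab: "a = (i1, j1, k1)" "b = (i2, j2, k2)" by (cases a, cases b)
  define r where "r u v = round (h * (sin (\<delta> * of_int u) + cos (\<delta> * of_int v)) / \<delta>)" for u v :: int
  have r: "r u v = r u' v'" if "u mod N = u' mod N" "v mod N = v' mod N" for u v u' v'
    unfolding r_def using sin_cos_lattice_mod[OF N that(1)] sin_cos_lattice_mod[OF N that(2)] by simp
  have cancel: "u mod N = v mod N" if "(u + w) mod N = (v + w) mod N" for u v w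
    using mod_diff_cong[OF that refl, of w] by simp
  define I1 J1 where "I1 = i1 + r k1 j1" and "J1 = j1 + r I1 k1"
  define I2 J2 where "I2 = i2 + r k2 j2" and "J2 = j2 + r I2 k2"
  have e: "I1 mod N = I2 mod N" "J1 mod N = J2 mod N" "(k1 + r J1 I1) mod N = (k2 + r J2 I2) mod N"
    using assms(3) unfolding ab by (auto simp: Let_def I1_def I2_def J1_def J2_def r_def)
  have k: "k1 mod N = k2 mod N" using e(3) unfolding r[OF e(2,1)] by (rule cancel)
  have j: "j1 mod N = j2 mod N" using e(2) unfolding J1_def J2_def r[OF e(1) k] by (rule cancel)
  have i: "i1 mod N = i2 mod N" using e(1) unfolding I1_def I2_def r[OF k j] by (rule cancel)
  show ?thesis using i j k by (simp add: ab)
qed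

lemma lattice_point_mod:
  assumes N: "0 < N" "\<delta> = 2 * pi / of_int N" and "reduce N a = reduce N b"
  shows "\<exists>l\<in>period_lattice. lattice_point \<delta> a = lattice_point \<delta> b + l"
proof -
  obtain i1 j1 k1 i2 j2 k2 where ab: "a = (i1, j1, k1)" "b = (i2, j2, k2)" by (cases a, cases b)
  have *: "\<exists>m::int. \<delta> * of_int u - \<delta> * of_int v = 2 * pi * of_int m" if "u mod N = v mod N" for u v :: int
    using lattice_coordinate_mod[OF N that] by (metis add_diff_cancel_left')
  have "lattice_point \<delta> a - lattice_point \<delta> b \<in> period_lattice"
    using assms(3) unfolding period_lattice_def ab
    by (simp add: forall_3 *)
  then show ?thesis by (intro bexI[of _ "lattice_point \<delta> a - lattice_point \<delta> b"]) auto
qed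

lemma rounded_step:
  assumes "0 < \<delta>" shows "\<bar>\<delta> * of_int (i + round (c / \<delta>)) - \<delta> * of_int i - c\<bar> \<le> \<delta> / 2"
proof -
  have "\<delta> * of_int (i + round (c / \<delta>)) - \<delta> * of_int i - c = \<delta> * (of_int (round (c / \<delta>)) - c / \<delta>)"
    using assms by (simp add: field_simps)
  also have "\<bar>\<dots>\<bar> \<le> \<delta> * (1 / 2)"
    unfolding abs_mult using assms of_int_round_abs_le[of "c / \<delta>"] by (intro mult_mono) auto
  finally show ?thesis by simp
qed

text \<open>Shears in succession differ from one Euler step by O(h^2), and rounding adds
  O(\<delta>), which is also O(h^2); a segment of duration h tolerates \<epsilon> h. The slack
  \<delta> at both ends lets a polygon enter or leave a lattice orbit at a neighbouring
  point.\<close>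

lemma lattice_step_seg:
  assumes h: "0 < h" "h \<le> 1" "63 * h + 6 * \<epsilon> * h \<le> \<epsilon>" and \<delta>: "0 < \<delta>" "\<delta> \<le> h\<^sup>2" and \<epsilon>: "0 < \<epsilon>"
    and x: "\<And>i. \<bar>x$i - lattice_point \<delta> c $ i\<bar> \<le> \<delta>"
    and y: "\<And>i. \<bar>y$i - lattice_point \<delta> (lattice_step h \<delta> c) $ i\<bar> \<le> \<delta>"
  shows "seg ABC_flow \<epsilon> x y h"
proof -
  obtain i j k where c: "c = (i, j, k)" by (cases c)
  define i' where "i' = i + round (h * (sin (\<delta> * of_int k) + cos (\<delta> * of_int j)) / \<delta>)"
  define j' where "j' = j + round (h * (sin (\<delta> * of_int i') + cos (\<delta> * of_int k)) / \<delta>)"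
  define k' where "k' = k + round (h * (sin (\<delta> * of_int j') + cos (\<delta> * of_int i')) / \<delta>)"
  have step: "lattice_step h \<delta> c = (i', j', k')" by (simp add: c Let_def i'_def j'_def k'_def)
  have X: "\<bar>x$1 - \<delta> * of_int i\<bar> \<le> \<delta>" "\<bar>x$2 - \<delta> * of_int j\<bar> \<le> \<delta>" "\<bar>x$3 - \<delta> * of_int k\<bar> \<le> \<delta>"
    using x[of 1] x[of 2] x[of 3] by (simp_all add: c)
  have Y: "\<bar>y$1 - \<delta> * of_int i'\<bar> \<le> \<delta>" "\<bar>y$2 - \<delta> * of_int j'\<bar> \<le> \<delta>" "\<bar>y$3 - \<delta> * of_int k'\<bar> \<le> \<delta>"
    using y[of 1] y[of 2] y[of 3] unfolding step by simp_all
  have S: "\<bar>\<delta> * of_int i' - \<delta> * of_int i - h * (sin (\<delta> * of_int k) + cos (\<delta> * of_int j))\<bar> \<le> \<delta> / 2"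
    "\<bar>\<delta> * of_int j' - \<delta> * of_int j - h * (sin (\<delta> * of_int i') + cos (\<delta> * of_int k))\<bar> \<le> \<delta> / 2"
    "\<bar>\<delta> * of_int k' - \<delta> * of_int k - h * (sin (\<delta> * of_int j') + cos (\<delta> * of_int i'))\<bar> \<le> \<delta> / 2"
    unfolding i'_def j'_def k'_def by (rule rounded_step[OF \<delta>(1)])+
  have diff: "\<bar>h * (sin a + cos b) - h * (sin a' + cos b')\<bar> \<le> h * (A + B)" if "\<bar>a - a'\<bar> \<le> A" "\<bar>b - b'\<bar> \<le> B" for a b a' b' A B :: real
  proof -
    have "\<bar>h * (sin a + cos b) - h * (sin a' + cos b')\<bar> = h * \<bar>(sin a - sin a') + (cos b - cos b')\<bar>"
      using h(1) by (simp add: abs_mult flip: right_diff_distrib) 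
    also have "\<dots> \<le> h * (A + B)"
      using h(1) that sin_lipschitz[of a a'] cos_lipschitz[of b b'] by (intro mult_left_mono) linarith+
    finally show ?thesis .
  qed
  have small: "\<bar>h * (sin a + cos b)\<bar> \<le> 2 * h" for a b :: real
  proof -
    have "\<bar>sin a + cos b\<bar> \<le> 2" using abs_sin_le_one[of a] abs_cos_le_one[of b] by linarith
    then have "h * \<bar>sin a + cos b\<bar> \<le> h * 2" using h(1) by (intro mult_left_mono) auto
    then show ?thesis using h(1) by (simp add: abs_mult)
  qed
  have hd: "h * \<delta> \<le> \<delta>" "0 \<le> h * h" using h \<delta> by (auto simp: mult_le_cancel_right1)
  \<comment> \<open>The later shears see coordinates that have already moved by up to 2 h plus
    rounding; this is the source of the h^2 terms.\<close>
  have I: "\<bar>\<delta> * of_int i' - x$1\<bar> \<le> 2 * h + 3 / 2 * \<delta>"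
    using X(1) S(1) small[of "\<delta> * of_int k" "\<delta> * of_int j"] by linarith
  have J: "\<bar>\<delta> * of_int j' - x$2\<bar> \<le> 2 * h + 3 / 2 * \<delta>"
    using X(2) S(2) small[of "\<delta> * of_int i'" "\<delta> * of_int k"] by linarith
  have K: "\<bar>\<delta> * of_int k - x$3\<bar> \<le> \<delta>" "\<bar>\<delta> * of_int j - x$2\<bar> \<le> \<delta>" using X by linarith+
  have chain: "\<bar>v - u - F'\<bar> \<le> \<delta> + \<delta> + \<delta> / 2 + B"
    if "\<bar>u - p\<bar> \<le> \<delta>" "\<bar>v - q\<bar> \<le> \<delta>" "\<bar>q - p - F\<bar> \<le> \<delta> / 2" "\<bar>F - F'\<bar> \<le> B" for u v p q F F' B
    using that by linarith
  have B: "h * (\<delta> + \<delta>) \<le> 2 * \<delta>" "h * (2 * h + 3 / 2 * \<delta> + \<delta>) \<le> 2 * (h * h) + 5 / 2 * \<delta>"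
    "h * (2 * h + 3 / 2 * \<delta> + (2 * h + 3 / 2 * \<delta>)) \<le> 4 * (h * h) + 3 * \<delta>"
    using hd by (simp_all add: algebra_simps)
  have 1: "\<bar>y$1 - x$1 - h * (sin (x$3) + cos (x$2))\<bar> \<le> 5 * \<delta>"
    using chain[OF X(1) Y(1) S(1) diff[OF K]] B(1) \<delta>(1) by linarith
  have 2: "\<bar>y$2 - x$2 - h * (sin (x$1) + cos (x$3))\<bar> \<le> 2 * (h * h) + 5 * \<delta>"
    using chain[OF X(2) Y(2) S(2) diff[OF I K(1)]] B(2) \<delta>(1) by linarith
  have 3: "\<bar>y$3 - x$3 - h * (sin (x$2) + cos (x$1))\<bar> \<le> 4 * (h * h) + 5.5 * \<delta>"
    using chain[OF X(3) Y(3) S(3) diff[OF J I]] B(3) \<delta>(1) by linarith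
  interpret drift ABC_flow \<epsilon> 6 6 by (rule drift_ABC[OF \<epsilon>])
  show ?thesis
  proof (rule segI)
    show "0 \<le> h" using h by simp
    \<comment> \<open>Here 15.5 = 5 + 5 + 5.5 collects the multiples of \<delta>. With \<delta>
      \<le> h^2 the sum is at most 22 h^2, and \<open>segI\<close> then asks for 22 + 6 * 6 = 58 in
      place of the 63 assumed.\<close>
    have "norm (y - x - h *\<^sub>R ABC_flow x) \<le> 6 * (h * h) + 15.5 * \<delta>"
      using norm_le_sum_3[of "y - x - h *\<^sub>R ABC_flow x"] 1 2 3
      unfolding vector_minus_component vector_scaleR_component ABC_flow_nth real_scaleR_def by linarith
    also have "\<dots> \<le> 22 * (h * h)" using \<delta>(2) hd unfolding power2_eq_square by linarith
    finally show "norm (y - x - h *\<^sub>R ABC_flow x) \<le> (22 * h) * h" by simp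
    show "22 * h \<le> \<epsilon>" "22 * h + 6 * ((6 + \<epsilon>) * h) \<le> \<epsilon>" using h(1,3) mult_pos_pos[OF \<epsilon> h(1)] by (simp_all add: algebra_simps)
  qed
qed

lemma lattice_point_near: 
  assumes "0 < \<delta>" shows "\<exists>a. \<forall>i. \<bar>x$i - lattice_point \<delta> a $ i\<bar> \<le> \<delta>"
proof -
  have *: "\<bar>u - \<delta> * of_int (round (u / \<delta>))\<bar> \<le> \<delta>" for u
    proof -
    have "\<bar>\<delta> * of_int (round (u / \<delta>)) - u\<bar> \<le> \<delta> / 2" using rounded_step[OF assms, of 0 u] by simp
    then show ?thesis using assms by linarith
  qed
  show ?thesis
    by (intro exI[of _ "(round (x$1 / \<delta>), round (x$2 / \<delta>), round (x$3 / \<delta>))"]) (simp add: forall_3 *)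
qed

text \<open>Once on the orbit of a lattice point, a polygon comes back to that point modulo periods.
  As the orbit can be joined from neighbouring points too, neighbours lead to each other, and chains
  of neighbours connect the whole lattice.\<close>

theorem ABC_controllable:
  assumes \<epsilon>: "0 < \<epsilon>"
  shows "\<exists>T. \<forall>x y. \<exists>t\<le>T. \<exists>l\<in>period_lattice. reach ABC_flow \<epsilon> x (y + l) t"
proof -
  define h where "h = \<epsilon> / (63 + 6 * \<epsilon>)"
  have h: "0 < h" "h \<le> 1" "63 * h + 6 * \<epsilon> * h \<le> \<epsilon>"
  proof -
    have "h * (63 + 6 * \<epsilon>) = \<epsilon>" using \<epsilon> by (simp add: h_def)
    then show "63 * h + 6 * \<epsilon> * h \<le> \<epsilon>" by (simp add: algebra_simps)
  qed (use \<epsilon> in \<open>auto simp: h_def\<close>)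
  \<comment> \<open>The mesh 2 pi / N divides the period and is at most h^2.\<close>
  define N where "N = \<lceil>2 * pi / h\<^sup>2\<rceil>"
  have Npos: "0 < 2 * pi / h\<^sup>2" using h by simp
  have N: "0 < N" "2 * pi / h\<^sup>2 \<le> of_int N" using Npos by (auto simp: N_def)
  define \<delta> where "\<delta> = 2 * pi / of_int N"
  have \<delta>: "0 < \<delta>" "\<delta> \<le> h\<^sup>2" using N h by (auto simp: \<delta>_def field_simps)
  note step = lattice_step_seg[OF h \<delta> \<epsilon>]
  let ?\<sigma> = "lattice_step h \<delta>"
  let ?pt = "lattice_point \<delta>"
  have fin: "finite (range (reduce N))"
  proof (rule finite_subset)
    show "range (reduce N) \<subseteq> {0..<N} \<times> {0..<N} \<times> {0..<N}" using N(1) by auto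
  qed simp
  \<comment> \<open>The orbit is followed from the image of \<open>c\<close> on, because the first
    step will be taken from a point near \<open>c\<close>.\<close>
  have orbit: "leads \<epsilon> (?pt (?\<sigma> c)) (?pt ((?\<sigma> ^^ Suc n) c))" for c n
  proof (induction n)
    case 0
    then show ?case by (auto intro: leads_reach reach_refl)
  next
    case (Suc n)
    have "seg ABC_flow \<epsilon> (?pt ((?\<sigma> ^^ Suc n) c)) (?pt ((?\<sigma> ^^ Suc (Suc n)) c)) h"
      using \<delta>(1) by (intro step[of _ "(?\<sigma> ^^ Suc n) c"]) auto
    from leads_trans[OF Suc leads_reach[OF seg_reach[OF this]]] show ?case .
  qed
  have return: "leads \<epsilon> x (?pt c)" if near: "\<And>i. \<bar>x$i - ?pt c $ i\<bar> \<le> \<delta>" for x c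
  proof -
    obtain n where n: "n > 0" "reduce N ((?\<sigma> ^^ n) c) = reduce N c"
      using finite_quotient_recurrent[OF fin lattice_step_inj_mod[OF N(1) \<delta>_def, where h = h], where a = c] by blast
    obtain l where l: "l \<in> period_lattice" "?pt ((?\<sigma> ^^ n) c) = ?pt c + l"
      using lattice_point_mod[OF N(1) \<delta>_def n(2)] by blast
    have 1: "leads \<epsilon> x (?pt (?\<sigma> c))"
      using step[OF near, of "?pt (?\<sigma> c)"] \<delta>(1) by (auto intro: leads_reach seg_reach)
    obtain m where "n = Suc m" using n(1) gr0_implies_Suc by blast
    then have "leads \<epsilon> x (?pt c + l)" using leads_trans[OF 1 orbit[of c m]] l(2) by simp
    then show ?thesis unfolding leads_def using period_lattice_add[OF l(1)] by (metis add.assoc)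
  qed
  have shift: "leads \<epsilon> (?pt a) (?pt b)" if "\<And>i. \<bar>?pt a $ i - ?pt b $ i\<bar> \<le> \<delta>" for a b
    using return[OF that] .
  have line: "leads \<epsilon> (?pt (f a)) (?pt (f b))"
    if f: "\<And>u v i. \<bar>u - v\<bar> \<le> 1 \<Longrightarrow> \<bar>?pt (f u) $ i - ?pt (f v) $ i\<bar> \<le> \<delta>" for f and a b :: int
  proof (induction b rule: int_induct[of _ a])
    case base
    show ?case by (rule leads_reach[OF reach_refl])
  next
    case (step1 i)
    then show ?case using leads_trans[OF _ shift[OF f[of i "i + 1"]]] by simp
  next
    case (step2 i)
    then show ?case using leads_trans[OF _ shift[OF f[of i "i - 1"]]] by simp
  qed
  have close: "\<bar>\<delta> * of_int u - \<delta> * of_int v\<bar> \<le> \<delta>" if "\<bar>u - v\<bar> \<le> 1" for u v :: int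
  proof -
    have "\<bar>of_int u - of_int v\<bar> \<le> (1::real)" using that by linarith
    then have "\<delta> * \<bar>of_int u - of_int v\<bar> \<le> \<delta> * 1" using \<delta>(1) by (intro mult_left_mono) auto
    then show ?thesis using \<delta>(1) by (simp add: abs_mult flip: right_diff_distrib)
  qed
  have all_three: "\<And>i::3. P i" if "P 1" "P 2" "P 3" for P using that by (metis exhaust_3)
  have lattice: "leads \<epsilon> (?pt a) (?pt b)" for a b
  proof -
    obtain i1 j1 k1 i2 j2 k2 where ab: "a = (i1, j1, k1)" "b = (i2, j2, k2)" by (cases a, cases b)
    have "leads \<epsilon> (?pt (i1, j1, k1)) (?pt (i2, j1, k1))"
      by (rule line[of "\<lambda>u. (u, j1, k1)"], rule all_three) (auto intro: close simp: \<delta>(1)[THEN less_imp_le])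
    moreover have "leads \<epsilon> (?pt (i2, j1, k1)) (?pt (i2, j2, k1))"
      by (rule line[of "\<lambda>u. (i2, u, k1)"], rule all_three) (auto intro: close simp: \<delta>(1)[THEN less_imp_le])
    moreover have "leads \<epsilon> (?pt (i2, j2, k1)) (?pt (i2, j2, k2))"
      by (rule line[of "\<lambda>u. (i2, j2, u)"], rule all_three) (auto intro: close simp: \<delta>(1)[THEN less_imp_le])
    ultimately show ?thesis unfolding ab using leads_trans by blast
  qed
  obtain \<tau> where \<tau>: "\<And>a b. \<exists>l\<in>period_lattice. reach ABC_flow \<epsilon> (?pt a) (?pt b + l) (\<tau> a b)"
    using lattice unfolding leads_def by metis
  \<comment> \<open>Lattice points have finitely many residues, so finitely many connection times
    suffice. The bound 2 h + T below adds one step onto the lattice and one off it.\<close>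
  define T where "T = Max ((\<lambda>(a, b). \<tau> a b) ` (range (reduce N) \<times> range (reduce N)))"
  have T: "\<tau> (reduce N a) (reduce N b) \<le> T" for a b
    unfolding T_def using fin by (intro Max_ge) auto
  have red: "reduce N (reduce N a) = reduce N a" for a by (cases a) simp
  have "\<exists>t\<le>2 * h + T. \<exists>l\<in>period_lattice. reach ABC_flow \<epsilon> x (y + l) t" for x y
  proof -
    obtain a where a: "\<And>i. \<bar>x$i - ?pt a $ i\<bar> \<le> \<delta>" using lattice_point_near[OF \<delta>(1)] by blast
    obtain b where b: "\<And>i. \<bar>y$i - ?pt b $ i\<bar> \<le> \<delta>" using lattice_point_near[OF \<delta>(1)] by blast
    obtain c where c: "?\<sigma> c = b" using lattice_step_surj by blast
    have first: "reach ABC_flow \<epsilon> x (?pt (?\<sigma> a)) h" using \<delta>(1) by (intro seg_reach step[OF a]) auto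
    have last: "reach ABC_flow \<epsilon> (?pt c) y h" using \<delta>(1) b by (intro seg_reach step[of _ c]) (auto simp: c)
    obtain l1 where l1: "l1 \<in> period_lattice" "?pt (?\<sigma> a) = ?pt (reduce N (?\<sigma> a)) + l1"
      using lattice_point_mod[OF N(1) \<delta>_def, of "?\<sigma> a" "reduce N (?\<sigma> a)"] red by auto
    obtain l2 where l2: "l2 \<in> period_lattice" "?pt (reduce N c) = ?pt c + l2"
      using lattice_point_mod[OF N(1) \<delta>_def, of "reduce N c" c] red by auto
    obtain l3 where l3: "l3 \<in> period_lattice"
      "reach ABC_flow \<epsilon> (?pt (reduce N (?\<sigma> a))) (?pt (reduce N c) + l3) (\<tau> (reduce N (?\<sigma> a)) (reduce N c))"
      using \<tau> by blast
    have L: "l2 + l3 + l1 \<in> period_lattice" using l1 l2 l3 by (intro period_lattice_add)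
    have "reach ABC_flow \<epsilon> (?pt (?\<sigma> a)) (?pt c + (l2 + l3 + l1)) (\<tau> (reduce N (?\<sigma> a)) (reduce N c))"
      using reach_period[OF l1(1) l3(2)] unfolding l1(2)[symmetric] l2(2) by (simp add: add.assoc)
    from reach_trans[OF reach_trans[OF first this] reach_period[OF L last]]
    have "reach ABC_flow \<epsilon> x (y + (l2 + l3 + l1)) (h + \<tau> (reduce N (?\<sigma> a)) (reduce N c) + h)" .
    moreover have "h + \<tau> (reduce N (?\<sigma> a)) (reduce N c) + h \<le> 2 * h + T" using T[of "?\<sigma> a" c] by simp
    ultimately show ?thesis using L by blast
  qed
  then show ?thesis by blast
qed

section \<open>Ballistic orbits of the ABC flow\<close>

lemma cos_ge_quarter: "\<bar>u\<bar> \<le> pi / 4 \<Longrightarrow> sqrt 2 / 2 \<le> cos u" for u :: real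
  using cos_monotone_0_pi_le[of "\<bar>u\<bar>" "pi/4"] by (simp add: cos_45)

lemma abs_sin_le_quarter: "\<bar>u\<bar> \<le> pi / 4 \<Longrightarrow> \<bar>sin u\<bar> \<le> sqrt 2 / 2" for u :: real
proof -
  assume "\<bar>u\<bar> \<le> pi / 4"
  then have u: "- (pi / 4) \<le> u" "u \<le> pi / 4" "- (pi / 2) \<le> u" "u \<le> pi / 2" by linarith+
  then show ?thesis
    using sin_monotone_2pi_le[OF u(3,2)] sin_monotone_2pi_le[OF _ u(1,4)] by (simp add: sin_45 abs_le_iff)
qed

lemma sin_add_cos_le: "sin x + cos x \<le> sqrt 2" for x :: real
proof (rule real_le_rsqrt)
  have "(sin x + cos x)\<^sup>2 + (sin x - cos x)\<^sup>2 = 2 * ((sin x)\<^sup>2 + (cos x)\<^sup>2)"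
    by (simp add: power2_eq_square algebra_simps)
  then show "(sin x + cos x)\<^sup>2 \<le> 2" using zero_le_power2[of "sin x - cos x"] unfolding sin_cos_squared_add by linarith
qed

text \<open>Euler polygon of the flow with the first coordinate as independent variable. The state
  \<open>(y, w)\<close> stands for the point \<open>(x, y, pi/2 + w)\<close>.\<close>
primrec euler_polygon :: "real \<Rightarrow> real \<Rightarrow> nat \<Rightarrow> real \<times> real"
  where
    "euler_polygon h y0 0 = (y0, 0)"
  | "euler_polygon h y0 (Suc n) = (case euler_polygon h y0 n of (y, w) \<Rightarrow>
       (y + h * ((sin (n * h) - sin w) / (cos w + cos y)),
        w + h * ((cos (n * h) + sin y) / (cos w + cos y))))"

text \<open>The bounds make the region self-consistent: slopes of w between 0 and 1 preserve 0 \<le>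
  w \<le> x, and slopes of y between 0 and 1/2 keep \<bar>y\<bar> \<le> pi/4 while x runs up to
  pi/4.\<close>

lemma euler_slopes:
  assumes "0 \<le> w" "w \<le> x" "x \<le> pi / 4" "\<bar>y\<bar> \<le> pi / 4"
  shows "sqrt 2 \<le> cos w + cos y"
    and "0 \<le> (sin x - sin w) / (cos w + cos y)" "(sin x - sin w) / (cos w + cos y) \<le> 1 / 2"
    and "0 \<le> (cos x + sin y) / (cos w + cos y)" "(cos x + sin y) / (cos w + cos y) \<le> 1"
proof -
  have c: "sqrt 2 / 2 \<le> cos w" "sqrt 2 / 2 \<le> cos y" "sqrt 2 / 2 \<le> cos x"
    by (rule cos_ge_quarter, use assms in linarith)+
  have s: "\<bar>sin y\<bar> \<le> sqrt 2 / 2" "\<bar>sin x\<bar> \<le> sqrt 2 / 2" by (rule abs_sin_le_quarter, use assms in linarith)+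
  show D: "sqrt 2 \<le> cos w + cos y" using c by linarith
  then have Dp: "0 < cos w + cos y" by (smt (verit) real_sqrt_gt_0_iff)
  have "sin w \<le> sin x" using assms by (intro sin_monotone_2pi_le) auto
  then show "0 \<le> (sin x - sin w) / (cos w + cos y)" using Dp by simp
  have "0 \<le> sin w" using assms by (intro sin_ge_zero) auto
  then have "2 * sin x - 2 * sin w \<le> cos w + cos y" using s D by linarith
  then show "(sin x - sin w) / (cos w + cos y) \<le> 1 / 2" using Dp by (simp add: pos_divide_le_eq)
  show "0 \<le> (cos x + sin y) / (cos w + cos y)" using Dp c s by (intro divide_nonneg_pos) linarith+
  have "cos x \<le> cos w" using assms by (intro cos_monotone_0_pi_le) auto
  then have "cos x + sin y \<le> cos w + cos y" using c s by linarith
  then show "(cos x + sin y) / (cos w + cos y) \<le> 1" using Dp by (simp add: pos_divide_le_eq)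
qed

lemma euler_polygon_bounds:
  assumes "- (pi / 4) \<le> y0" "y0 \<le> 0" "0 \<le> h" "n * h \<le> pi / 4"
    and "euler_polygon h y0 n = (y, w)"
  shows "0 \<le> w \<and> w \<le> n * h \<and> y0 \<le> y \<and> y \<le> y0 + n * h / 2 \<and> \<bar>y\<bar> \<le> pi / 4"
  using assms(4,5)
proof (induction n arbitrary: y w)
  case 0
  then show ?case using assms by auto
next
  case (Suc n)
  obtain y' w' where e: "euler_polygon h y0 n = (y', w')" by fastforce
  have nh: "n * h \<le> pi / 4" using Suc.prems(1) assms(3) by (simp add: algebra_simps)
  note IH = Suc.IH[OF nh e]
  let ?F = "(sin (n * h) - sin w') / (cos w' + cos y')"
  let ?G = "(cos (n * h) + sin y') / (cos w' + cos y')"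
  have yw: "y = y' + h * ?F" "w = w' + h * ?G" using Suc.prems(2) e by auto
  have c: "0 \<le> w'" "w' \<le> n * h" "\<bar>y'\<bar> \<le> pi / 4" using IH by auto
  note F = euler_slopes(2,3)[OF c(1,2) nh c(3)] and G = euler_slopes(4,5)[OF c(1,2) nh c(3)]
  have "0 \<le> h * ?F" "h * ?F \<le> h * (1 / 2)" "0 \<le> h * ?G" "h * ?G \<le> h * 1"
    by (intro mult_nonneg_nonneg mult_left_mono F G assms(3))+
  moreover have "Suc n * h = n * h + h" by (simp add: algebra_simps)
  ultimately have "0 \<le> w \<and> w \<le> Suc n * h \<and> y0 \<le> y \<and> y \<le> y0 + Suc n * h / 2"
    using IH unfolding yw by (simp add: field_simps)
  moreover from this have "\<bar>y\<bar> \<le> pi / 4" using Suc.prems(1) assms by (auto simp: abs_le_iff)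
  ultimately show ?case by blast
qed

text \<open>While y \<le> 0 \<le> w, the numerators of the two slopes add up to at most sin x + cos
  x \<le> sqrt 2, which is at most the denominator. So y + w grows no faster than x.\<close>

lemma euler_polygon_end_neg:
  assumes "0 \<le> h" "n * h \<le> pi / 4" "euler_polygon h (- (pi / 4)) n = (y, w)"
  shows "y + w \<le> - (pi / 4) + n * h"
  using assms(2,3)
proof (induction n arbitrary: y w)
  case 0
  then show ?case by auto
next
  case (Suc n)
  obtain y' w' where e: "euler_polygon h (- (pi / 4)) n = (y', w')" by fastforce
  have nh: "n * h \<le> pi / 4" using Suc.prems(1) assms(1) by (simp add: algebra_simps)
  note B = euler_polygon_bounds[OF _ _ assms(1) nh e]
  have B: "0 \<le> w'" "w' \<le> n * h" "- (pi / 4) \<le> y'" "y' \<le> - (pi / 4) + n * h / 2" "\<bar>y'\<bar> \<le> pi / 4" using B by auto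
  have D: "sqrt 2 \<le> cos w' + cos y'" using euler_slopes(1)[OF B(1,2) nh B(5)] .
  have "y' \<le> 0" using B(4) nh pi_gt_zero by linarith
  then have "sin y' \<le> 0" using sin_ge_zero[of "- y'"] B(3) by simp
  moreover have "0 \<le> sin w'" using B nh by (intro sin_ge_zero) auto
  ultimately have "(sin (n * h) - sin w') + (cos (n * h) + sin y') \<le> cos w' + cos y'"
    using D sin_add_cos_le[of "n * h"] by linarith
  moreover have "0 < cos w' + cos y'" using D by (smt (verit) real_sqrt_gt_0_iff)
  ultimately have "(sin (n * h) - sin w') / (cos w' + cos y') + (cos (n * h) + sin y') / (cos w' + cos y') \<le> 1"
    by (simp add: pos_divide_le_eq flip: add_divide_distrib)
  then have "h * ((sin (n * h) - sin w') / (cos w' + cos y') + (cos (n * h) + sin y') / (cos w' + cos y')) \<le> h * 1"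
    using assms(1) by (intro mult_left_mono)
  then show ?case using Suc.IH[OF nh e] Suc.prems(2) e by (auto simp: algebra_simps)
qed

lemma euler_polygon_continuous:
  assumes "0 \<le> h" "n * h \<le> pi / 4"
  shows "continuous_on {- (pi / 4)..0} (\<lambda>y0. fst (euler_polygon h y0 n))
    \<and> continuous_on {- (pi / 4)..0} (\<lambda>y0. snd (euler_polygon h y0 n))"
  using assms(2)
proof (induction n)
  case 0
  then show ?case by (simp add: continuous_on_id)
next
  case (Suc n)
  have nh: "n * h \<le> pi / 4" using Suc.prems(1) assms(1) by (simp add: algebra_simps)
  have "cos (snd (euler_polygon h y0 n)) + cos (fst (euler_polygon h y0 n)) \<noteq> 0" if "y0 \<in> {- (pi / 4)..0}" for y0
  proof -
    obtain y w where e: "euler_polygon h y0 n = (y, w)" by fastforce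
    have "sqrt 2 \<le> cos w + cos y"
      using euler_polygon_bounds[OF _ _ assms(1) nh e] that nh by (intro euler_slopes(1)[of w "n * h"]) auto
    then have "cos w + cos y \<noteq> 0" by (smt (verit) real_sqrt_gt_0_iff)
    then show ?thesis by (simp add: e)
  qed
  then show ?case using Suc.IH[OF nh] by (auto simp: case_prod_unfold intro!: continuous_intros)
qed

text \<open>The target line reads y + w = 0. At x = pi/4 the sum y + w is at most 0 for y0 = -pi/4
  and at least 0 for y0 = 0, and the polygon depends continuously on y0, so some polygon ends
  exactly on the line.\<close>

lemma quarter_orbit:
  assumes \<epsilon>: "0 < \<epsilon>"
  shows "\<exists>y0 a b t. t \<le> pi / 4 \<and> a + b = pi / 2 \<and>
    reach ABC_flow \<epsilon> (vector [0, y0, pi / 2]) (vector [pi / 4, a, b]) t"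
proof -
  interpret drift ABC_flow \<epsilon> 6 6 by (rule drift_ABC[OF \<epsilon>])
  \<comment> \<open>Makes 6 (6 + \<epsilon>) h \<le> \<epsilon>, the condition of
    \<open>segI\<close> for an exact Euler step (\<eta> = 0).\<close>
  define N :: nat where "N = nat \<lceil>pi / 4 * (6 * (6 + \<epsilon>)) / \<epsilon>\<rceil>"
  have Npos: "0 < pi / 4 * (6 * (6 + \<epsilon>)) / \<epsilon>" using \<epsilon> by simp
  have N: "0 < N" "pi / 4 * (6 * (6 + \<epsilon>)) / \<epsilon> \<le> real N"
    using Npos real_nat_ceiling_ge[of "pi / 4 * (6 * (6 + \<epsilon>)) / \<epsilon>"] by (auto simp: N_def)
  define h where "h = pi / 4 / N"
  have h: "0 < h" "real N * h = pi / 4" using N by (auto simp: h_def)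
  have hs: "6 * ((6 + \<epsilon>) * h) \<le> \<epsilon>" using N \<epsilon> by (simp add: h_def field_simps)
  define f where "f y0 = fst (euler_polygon h y0 N) + snd (euler_polygon h y0 N)" for y0
  have Nh: "real N * h \<le> pi / 4" using h by simp
  have "continuous_on {- (pi / 4)..0} f"
    unfolding f_def[abs_def] using euler_polygon_continuous[OF less_imp_le[OF h(1)] Nh] by (auto intro: continuous_on_add)
  moreover have "f (- (pi / 4)) \<le> 0"
    using euler_polygon_end_neg[OF less_imp_le[OF h(1)] Nh prod.collapse[symmetric]] h(2) by (simp add: f_def)
  moreover have "0 \<le> f 0"
    using euler_polygon_bounds[OF _ _ less_imp_le[OF h(1)] Nh prod.collapse[symmetric], of 0] by (simp add: f_def)
  ultimately obtain y0 where y0: "- (pi / 4) \<le> y0" "y0 \<le> 0" "f y0 = 0"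
    using IVT'[of f "- (pi / 4)" 0 0] by auto
  define pt where "pt n = (case euler_polygon h y0 n of (y, w) \<Rightarrow> (vector [n * h, y, pi / 2 + w] :: real^3))" for n :: nat
  have "n \<le> N \<Longrightarrow> \<exists>t \<le> n * h. reach ABC_flow \<epsilon> (pt 0) (pt n) t" for n
  proof (induction n)
    case 0
    then show ?case by (auto intro!: exI[of _ 0] reach_refl)
  next
    case (Suc n)
    obtain t where t: "t \<le> n * h" "reach ABC_flow \<epsilon> (pt 0) (pt n) t" using Suc by auto
    obtain y w where e: "euler_polygon h y0 n = (y, w)" by fastforce
    have "real n * h \<le> real N * h" using Suc.prems h(1) by (intro mult_right_mono) auto
    then have nh: "n * h \<le> pi / 4" using h by simp
    let ?D = "cos w + cos y"
    have D: "sqrt 2 \<le> ?D"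
      using euler_polygon_bounds[OF y0(1,2) less_imp_le[OF h(1)] nh e] nh by (intro euler_slopes(1)[of w "n * h"]) auto
    then have D1: "1 \<le> ?D" by (smt (verit) real_sqrt_ge_1_iff)
    \<comment> \<open>At this vertex the first component of the flow is \<open>?D\<close>, so
      advancing x by \<open>h\<close> takes time h / \<open>?D\<close>, which is at most
      \<open>h\<close>.\<close>
    define \<tau> where "\<tau> = h / ?D"
    have \<tau>: "0 \<le> \<tau>" "\<tau> \<le> h" using D1 h(1) divide_left_mono[OF D1, of h] by (auto simp: \<tau>_def)
    have "pt (Suc n) - pt n = \<tau> *\<^sub>R ABC_flow (pt n)"
      using D1 by (auto simp: pt_def e vec_eq_iff forall_3 sin_add cos_add \<tau>_def algebra_simps)
        (use D1 in \<open>simp flip: distrib_left\<close>)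
    then have "seg ABC_flow \<epsilon> (pt n) (pt (Suc n)) \<tau>"
      using \<tau> hs \<epsilon> mult_left_mono[OF \<tau>(2), of "6 * (6 + \<epsilon>)"]
      by (intro segI[where \<eta> = 0]) (auto simp: algebra_simps)
    from reach_step[OF t(2) this] show ?case using t(1) \<tau>(2)
      by (intro exI[of _ "t + \<tau>"]) (auto simp: algebra_simps)
  qed
  from this[of N] obtain t where "t \<le> pi / 4" "reach ABC_flow \<epsilon> (pt 0) (pt N) t" using h by auto
  moreover obtain a w where e: "euler_polygon h y0 N = (a, w)" by fastforce
  moreover have "pt 0 = vector [0, y0, pi / 2]" by (simp add: pt_def)
  moreover have "pt N = vector [pi / 4, a, pi / 2 + w]" unfolding pt_def e h(2) by simp
  moreover have "a + (pi / 2 + w) = pi / 2" using y0(3) by (simp add: f_def e)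
  ultimately show ?thesis by metis
qed

section \<open>Symmetries and ballistic orbits\<close>

lemma linear_vector_3:
  fixes f g h :: "real^3 \<Rightarrow> real"
  assumes "linear f" "linear g" "linear h"
  shows "linear (\<lambda>v. vector [f v, g v, h v] :: real^3)"
  using assms by (simp add: linear_iff vec_eq_iff forall_3)

lemma linear_component: "linear (\<lambda>v::real^3. v$i)" "linear (\<lambda>v::real^3. - v$i)"
  by (simp_all add: linear_iff)

lemma norm_sum_3: "norm (v::real^3) = sqrt ((v$1)\<^sup>2 + (v$2)\<^sup>2 + (v$3)\<^sup>2)"
  by (simp add: norm_vec_def L2_set_def sum_3)

text \<open>Reflecting the orbit at its two end points, which lie on the axes of time-reversing half
  turns, yields an orbit that is carried along itself by a screw motion of order four.\<close>
lemma ballistic_first_axis: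
  assumes \<epsilon>: "0 < \<epsilon>"
  shows "\<exists>x t. t \<le> 2 * pi \<and> reach ABC_flow \<epsilon> x (x + (2 * pi) *\<^sub>R axis 1 1) t"
proof -
  obtain y0 a b t where t: "t \<le> pi / 4" "a + b = pi / 2"
    "reach ABC_flow \<epsilon> (vector [0, y0, pi / 2]) (vector [pi / 4, a, b]) t"
    using quarter_orbit[OF \<epsilon>] by blast
  let ?P = "vector [0, y0, pi / 2] :: real^3" and ?Q = "vector [pi / 4, a, b] :: real^3"
  \<comment> \<open>With the shift \<open>?a\<close>, \<open>?A\<close> is the half turn about {x =
    0, z = pi/2}; with \<open>?b\<close>, \<open>?B\<close> is the half turn about {x = pi/4, y + z
    = pi/2}. Their composition is \<open>?S\<close> with shift \<open>?s\<close>, a quarter turn of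
    the last two coordinates combined with an advance of pi/2 in x.\<close>
  let ?A = "\<lambda>v::real^3. vector [- v$1, v$2, - v$3] :: real^3" and ?a = "vector [0, 0, pi] :: real^3"
  let ?B = "\<lambda>v::real^3. vector [- v$1, - v$3, - v$2] :: real^3" and ?b = "vector [pi/2, pi/2, pi/2] :: real^3"
  let ?S = "\<lambda>v::real^3. vector [v$1, v$3, - v$2] :: real^3" and ?s = "vector [pi/2, - pi/2, pi/2] :: real^3"
  have A: "reach ABC_flow \<epsilon> (?A y + ?a) (?A x + ?a) t" if "reach ABC_flow \<epsilon> x y t" for x y t
    by (rule reach_reverse_isometry[OF _ _ _ that])
      (auto intro!: linear_vector_3 linear_component simp: norm_sum_3 vec_eq_iff forall_3 sin_add cos_add sin_diff cos_diff)
  have B: "reach ABC_flow \<epsilon> (?B y + ?b) (?B x + ?b) t" if "reach ABC_flow \<epsilon> x y t" for x y t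
    by (rule reach_reverse_isometry[OF _ _ _ that])
      (auto intro!: linear_vector_3 linear_component simp: norm_sum_3 vec_eq_iff forall_3 sin_add cos_add sin_diff cos_diff)
  have S: "reach ABC_flow \<epsilon> (?S x + ?s) (?S y + ?s) t" if "reach ABC_flow \<epsilon> x y t" for x y t
    by (rule reach_isometry[OF _ _ _ that])
      (auto intro!: linear_vector_3 linear_component simp: norm_sum_3 vec_eq_iff forall_3 sin_add cos_add sin_diff cos_diff)
  have "?A ?P + ?a = ?P" by (simp add: vec_eq_iff forall_3)
  then have 1: "reach ABC_flow \<epsilon> (?A ?Q + ?a) ?Q (t + t)" using reach_trans[OF A[OF t(3)], of ?Q t] t(3) by simp
  have Q: "?B ?Q + ?b = ?Q" using t(2) by (simp add: vec_eq_iff forall_3)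
  have "?B (?A ?Q + ?a) + ?b = ?S ?Q + ?s" by (simp add: vec_eq_iff forall_3)
  \<comment> \<open>The second half turn fixes \<open>?Q\<close>, hence maps the piece arriving at
    \<open>?Q\<close> to a piece leaving it, whose end is the screw image of \<open>?Q\<close>. Each
    screw step thus takes time 2 t, and four of them advance x by 2 pi.\<close>
  then have 2: "reach ABC_flow \<epsilon> ?Q (?S ?Q + ?s) (t + t)" using B[OF 1] unfolding Q by simp
  let ?f = "\<lambda>x. ?S x + ?s"
  have 4: "reach ABC_flow \<epsilon> ?Q (?f (?f ?Q)) (4 * t)" using reach_trans[OF 2 S[OF 2]] by simp
  have "reach ABC_flow \<epsilon> ?Q (?f (?f (?f (?f ?Q)))) (8 * t)" using reach_trans[OF 4 S[OF S[OF 4]]] by simp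
  moreover have "?f (?f (?f (?f ?Q))) = ?Q + (2 * pi) *\<^sub>R axis 1 1"
    by (simp add: vec_eq_iff forall_3 axis_def)
  moreover have "8 * t \<le> 2 * pi" using t(1) by simp
  ultimately show ?thesis by metis
qed

text \<open>The three coefficients are equal, so cyclic permutations of the coordinates preserve the
  flow and carry one axis to the others.\<close>

lemma ballistic_axis:
  assumes \<epsilon>: "0 < \<epsilon>"
  shows "\<exists>x t. t \<le> 2 * pi \<and> reach ABC_flow \<epsilon> x (x + (2 * pi) *\<^sub>R axis i 1) t"
proof -
  let ?C = "\<lambda>v::real^3. vector [v$3, v$1, v$2] :: real^3"
  have C: "reach ABC_flow \<epsilon> (?C x) (?C y) t" if "reach ABC_flow \<epsilon> x y t" for x y t
  proof -
    have "reach ABC_flow \<epsilon> (?C x + 0) (?C y + 0) t"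
      by (rule reach_isometry[OF _ _ _ that])
        (auto intro!: linear_vector_3 linear_component simp: norm_sum_3 vec_eq_iff forall_3 algebra_simps)
    then show ?thesis by simp
  qed
  have 12: "?C (x + (2 * pi) *\<^sub>R axis 1 1) = ?C x + (2 * pi) *\<^sub>R axis 2 1"
    and 23: "?C (x + (2 * pi) *\<^sub>R axis 2 1) = ?C x + (2 * pi) *\<^sub>R axis 3 1" for x
    by (simp_all add: vec_eq_iff forall_3 axis_def)
  obtain x t where 1: "t \<le> 2 * pi" "reach ABC_flow \<epsilon> x (x + (2 * pi) *\<^sub>R axis 1 1) t"
    using ballistic_first_axis[OF \<epsilon>] by blast
  have 2: "reach ABC_flow \<epsilon> (?C x) (?C x + (2 * pi) *\<^sub>R axis 2 1) t" using C[OF 1(2)] unfolding 12 .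
  have 3: "reach ABC_flow \<epsilon> (?C (?C x)) (?C (?C x) + (2 * pi) *\<^sub>R axis 3 1) t" using C[OF 2] unfolding 23 .
  show ?thesis using 1 2 3 exhaust_3[of i] by metis
qed

text \<open>A shift by half a period in each coordinate changes the sign of every sine and
  cosine.\<close>

lemma reach_ABC_minus:
  assumes "reach ABC_flow \<epsilon> x y t"
  defines "c \<equiv> (\<chi> i. pi) :: real^3"
  shows "reach (\<lambda>v. - ABC_flow v) \<epsilon> (x + c) (y + c) t"
  by (rule reach_isometry[of "\<lambda>v. v" _ c, OF linear_ident _ _ assms(1)])
    (auto simp: c_def vec_eq_iff forall_3 sin_add cos_add)

text \<open>For the positive direction the orbit is translated by half a period; for the negative
  one it is traversed backwards.\<close>

lemma ballistic_axis_minus: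
  assumes \<epsilon>: "0 < \<epsilon>" and s: "s = 1 \<or> s = - 1"
  shows "\<exists>x t. t \<le> 2 * pi \<and> reach (\<lambda>v. - ABC_flow v) \<epsilon> x (x + (s * (2 * pi)) *\<^sub>R axis i 1) t"
proof -
  obtain x t where x: "t \<le> 2 * pi" "reach ABC_flow \<epsilon> x (x + (2 * pi) *\<^sub>R axis i 1) t"
    using ballistic_axis[OF \<epsilon>] by blast
  show ?thesis using s
  proof
    assume "s = 1"
    then show ?thesis using reach_ABC_minus[OF x(2)] x(1)
      by (intro exI[of _ "x + (\<chi> i. pi)"] exI[of _ t]) (simp add: add_ac)
  next
    assume s: "s = - 1"
    have "reach (\<lambda>v. - ABC_flow v) \<epsilon> (x + (2 * pi) *\<^sub>R axis i 1 + 0) (x + 0) t"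
      by (rule reach_reverse_isometry[of "\<lambda>v. v", OF linear_ident _ _ x(2)]) auto
    then have "reach (\<lambda>v. - ABC_flow v) \<epsilon> (x + (2 * pi) *\<^sub>R axis i 1)
        ((x + (2 * pi) *\<^sub>R axis i 1) + (s * (2 * pi)) *\<^sub>R axis i 1) t" by (simp add: s)
    then show ?thesis using x(1) by blast
  qed
qed

theorem ABC_minus_controllable:
  assumes \<epsilon>: "0 < \<epsilon>"
  shows "\<exists>T. \<forall>x y. \<exists>t\<le>T. \<exists>l\<in>period_lattice. reach (\<lambda>v. - ABC_flow v) \<epsilon> x (y + l) t"
proof -
  define c where "c = ((\<chi> i. pi) :: real^3)"
  obtain T where T: "\<And>x y. \<exists>t\<le>T. \<exists>l\<in>period_lattice. reach ABC_flow \<epsilon> x (y + l) t"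
    using ABC_controllable[OF \<epsilon>] by blast
  have "\<exists>t\<le>T. \<exists>l\<in>period_lattice. reach (\<lambda>v. - ABC_flow v) \<epsilon> x (y + l) t" for x y
  proof -
    obtain t l where "t \<le> T" "l \<in> period_lattice" "reach ABC_flow \<epsilon> (x - c) (y - c + l) t"
      using T[of "x - c" "y - c"] by blast
    then show ?thesis using reach_ABC_minus[of \<epsilon> "x - c" "y - c + l" t] unfolding c_def[symmetric]
      by (auto simp: algebra_simps)
  qed
  then show ?thesis by blast
qed

section \<open>Front speeds\<close>

text \<open>Fekete's lemma for a real variable: writing t = n t0 + r, the linear bound controls the
  remainder r, and the limit is the infimum of the rates.\<close>

lemma subadditive_rate:
  fixes f :: "real \<Rightarrow> real"
  assumes sub: "\<And>s t. 0 \<le> s \<Longrightarrow> 0 \<le> t \<Longrightarrow> f (s + t) \<le> f s + f t"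
    and bnd: "\<And>t. 0 \<le> t \<Longrightarrow> \<bar>f t\<bar> \<le> C * t"
  shows "\<exists>l. ((\<lambda>t. f t / t) \<longlongrightarrow> l) at_top"
proof -
  have C: "0 \<le> C" using bnd[of 1] by linarith
  have q: "\<bar>f t / t\<bar> \<le> C" if "0 < t" for t using bnd[of t] that by (simp add: field_simps)
  have mult: "f (real n * t) \<le> real n * f t" if "0 \<le> t" for n t
  proof (induction n)
    case 0
    then show ?case using bnd[of 0] by simp
  next
    case (Suc n)
    then show ?case using sub[of "real n * t" t] that by (simp add: algebra_simps)
  qed
  have key: "f t / t \<le> f t0 / t0 + 2 * C * t0 / t" if t0: "0 < t0" and t: "0 < t" for t0 t
  proof -
    define n where "n = nat \<lfloor>t / t0\<rfloor>"
    define r where "r = t - real n * t0"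
    have n: "real n \<le> t / t0" "t / t0 < real n + 1" using t0 t by (auto simp: n_def)
    have r: "0 \<le> r" "r \<le> t0" using n t0 by (auto simp: r_def field_simps)
    have 1: "f t \<le> real n * f t0 + f r"
      using sub[of "real n * t0" r] mult[of t0 n] t0 r by (simp add: r_def)
    have 2: "real n * f t0 = t * (f t0 / t0) + r * (- (f t0 / t0))" using t0 by (simp add: r_def field_simps)
    have "- (f t0 / t0) \<le> C" using q[OF t0] by linarith
    then have "r * (- (f t0 / t0)) \<le> r * C" using r by (intro mult_left_mono)
    moreover have "r * C \<le> t0 * C" using r C by (intro mult_right_mono)
    moreover have "f r \<le> t0 * C" using bnd[OF r(1)] mult_left_mono[OF r(2) C] by (simp add: mult.commute)
    ultimately have "f t \<le> t * (f t0 / t0) + 2 * (t0 * C)" using 1 unfolding 2 by linarith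
    then have "f t \<le> t * (f t0 / t0) + 2 * C * t0" by (simp add: mult.commute mult.left_commute)
    then have "f t / t \<le> (t * (f t0 / t0) + 2 * C * t0) / t" using t by (intro divide_right_mono) auto
    then show ?thesis using t by (simp add: add_divide_distrib)
  qed
  define l where "l = (INF t\<in>{0<..}. f t / t)"
  have bdd: "bdd_below ((\<lambda>t. f t / t) ` {0<..})"
  proof (rule bdd_belowI2)
    fix t :: real assume "t \<in> {0<..}"
    then have "\<bar>f t / t\<bar> \<le> C" by (intro q) simp
    then show "- C \<le> f t / t" by linarith
  qed
  have "((\<lambda>t. f t / t) \<longlongrightarrow> l) at_top"
  proof (rule order_tendstoI)
    fix a assume a: "a < l"
    show "\<forall>\<^sub>F t in at_top. a < f t / t"
      using eventually_gt_at_top[of "0::real"]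
    proof (rule eventually_mono)
      fix t :: real assume "0 < t"
      then have "l \<le> f t / t" unfolding l_def by (intro cINF_lower[OF bdd]) auto
      then show "a < f t / t" using a by simp
    qed
  next
    fix a assume "l < a"
    then have "\<exists>t\<in>{0<..}. f t / t < a" unfolding l_def by (subst (asm) cINF_less_iff[OF _ bdd]) auto
    then obtain t0 where t0: "0 < t0" "f t0 / t0 < a" by blast
    have "((\<lambda>t. 2 * C * t0 / t) \<longlongrightarrow> 0) at_top"
      by (intro tendsto_divide_0[OF tendsto_const] filterlim_at_top_imp_at_infinity filterlim_ident)
    from tendsto_add[OF tendsto_const this]
    have "((\<lambda>t. f t0 / t0 + 2 * C * t0 / t) \<longlongrightarrow> f t0 / t0 + 0) at_top" .
    then have "\<forall>\<^sub>F t in at_top. f t0 / t0 + 2 * C * t0 / t < a" using t0 by (intro order_tendstoD(2)) auto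
    then show "\<forall>\<^sub>F t in at_top. f t / t < a"
      using eventually_gt_at_top[of "0::real"]
    proof eventually_elim
      case (elim t)
      then show ?case using key[OF t0(1), of t] by linarith
    qed
  qed
  then show ?thesis by blast
qed

section \<open>Existence of the front speed and a lower bound\<close>

context drift begin

lemma val_period_le:
  assumes "\<And>z. W (z + l) = W z" "0 \<le> t" shows "val p (x + l) t \<le> val p x t + p \<bullet> l"
proof -
  have "val p (x + l) t - p \<bullet> l \<le> val p x t"
  proof (rule val_greatest[OF assms(2)])
    fix y assume "reach W \<epsilon> x y t"
    then have "reach W \<epsilon> (x + l) (y + l) t"
      using reach_isometry[of "\<lambda>v. v" W l W, OF linear_ident] assms(1) by blast
    then show "val p (x + l) t - p \<bullet> l \<le> p \<bullet> y" using val_le[of "x + l" "y + l" t p] by (simp add: inner_add_right)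
  qed
  then show ?thesis by simp
qed

text \<open>The maximal displacement \<open>m\<close> over all starting points is subadditive, so it
  has a rate. Steering any start to any other in time at most \<open>T\<close> makes individual
  displacements follow \<open>m\<close> up to a constant.\<close>

theorem front_speed_exists:
  assumes per: "\<And>l z. l \<in> \<Lambda> \<Longrightarrow> W (z + l) = W z"
    and contr: "\<And>x y. \<exists>t\<le>T. \<exists>l\<in>\<Lambda>. reach W \<epsilon> x (y + l) t"
  shows "\<exists>r. \<forall>x. ((\<lambda>t. - val p x t / t) \<longlongrightarrow> r) at_top"
proof -
  define C where "C = norm p * (M + \<epsilon>)"
  have C: "0 \<le> C" using M_nonneg \<epsilon>_pos by (simp add: C_def)
  have b: "\<bar>val p x t - p \<bullet> x\<bar> \<le> C * t" if "0 \<le> t" for x t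
    using val_bound[OF that, of p x] by (simp add: C_def mult.assoc)
  define m where "m t = (SUP x. p \<bullet> x - val p x t)" for t
  have bdd: "bdd_above (range (\<lambda>x. p \<bullet> x - val p x t))" if "0 \<le> t" for t
    using b[OF that] by (intro bdd_aboveI2[of _ _ "C * t"]) (auto simp: abs_le_iff algebra_simps)
  have up: "p \<bullet> x - val p x t \<le> m t" if "0 \<le> t" for x t
    unfolding m_def by (rule cSUP_upper[OF _ bdd[OF that]]) simp
  have least: "m t \<le> c" if "\<And>x. p \<bullet> x - val p x t \<le> c" for t c
    unfolding m_def by (rule cSUP_least) (use that in auto)
  have "m (s + t) \<le> m s + m t" if "0 \<le> s" "0 \<le> t" for s t
  proof (rule least)
    fix x
    have "val p x s - m t \<le> val p x (s + t)"
      by (rule val_add_ge[OF that]) (use up[OF that(2)] in \<open>simp add: algebra_simps\<close>)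
    then show "p \<bullet> x - val p x (s + t) \<le> m s + m t" using up[OF that(1), of x] by linarith
  qed
  moreover have "\<bar>m t\<bar> \<le> C * t" if "0 \<le> t" for t
  proof -
    have "m t \<le> C * t" using b[OF that] by (intro least) (auto simp: abs_le_iff algebra_simps)
    moreover have "- (C * t) \<le> m t" using up[OF that, of 0] b[OF that, of 0] by (simp add: abs_le_iff)
    ultimately show ?thesis by (simp add: abs_le_iff)
  qed
  ultimately obtain r where r: "((\<lambda>t. m t / t) \<longlongrightarrow> r) at_top"
    using subadditive_rate[of m C] by blast
  \<comment> \<open>One C T accounts for the time spent on steering, the other for the displacement
    during it; the period \<open>l\<close> drops out by periodicity.\<close>
  have low: "m t - 2 * C * T \<le> p \<bullet> x - val p x t" if t: "0 \<le> t" for x t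
  proof -
    have "m t \<le> p \<bullet> x - val p x t + 2 * C * T"
    proof (rule least)
      fix y
      obtain \<tau> l where \<tau>: "\<tau> \<le> T" "l \<in> \<Lambda>" "reach W \<epsilon> x (y + l) \<tau>" using contr by blast
      have \<tau>0: "0 \<le> \<tau>" using reach_nonneg[OF \<tau>(3)] .
      have 1: "val p x (\<tau> + t) \<le> val p y t + p \<bullet> l"
        using val_reach_le[OF \<tau>(3) t, of p] val_period_le[OF per[OF \<tau>(2)] t, of p y] by linarith
      have 2: "\<bar>val p x (\<tau> + t) - val p x t\<bar> \<le> C * \<tau>"
        using val_lipschitz_time[of "\<tau> + t" t p x] \<tau>0 t by (simp add: C_def)
      have 3: "\<bar>p \<bullet> (y + l) - p \<bullet> x\<bar> \<le> C * \<tau>"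
        using reach_inner_bound[OF \<tau>(3), of p] by (simp add: C_def mult.assoc)
      have "C * \<tau> \<le> C * T" using \<tau>(1) C by (intro mult_left_mono)
      then show "p \<bullet> y - val p y t \<le> p \<bullet> x - val p x t + 2 * C * T"
        using 1 2 3 by (simp add: inner_add_right abs_le_iff)
    qed
    then show ?thesis by simp
  qed
  have "((\<lambda>t. - val p x t / t) \<longlongrightarrow> r) at_top" for x
  proof -
    have zero: "((\<lambda>t. c / t) \<longlongrightarrow> 0) at_top" for c :: real
      by (intro tendsto_divide_0[OF tendsto_const] filterlim_at_top_imp_at_infinity filterlim_ident)
    have "((\<lambda>t. (p \<bullet> x - val p x t) / t) \<longlongrightarrow> r) at_top"
    proof (rule tendsto_sandwich)
      show "((\<lambda>t. m t / t - 2 * C * T / t) \<longlongrightarrow> r) at_top" using tendsto_diff[OF r zero] by simp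
      show "((\<lambda>t. m t / t) \<longlongrightarrow> r) at_top" by (rule r)
      show "\<forall>\<^sub>F t in at_top. m t / t - 2 * C * T / t \<le> (p \<bullet> x - val p x t) / t"
        using eventually_gt_at_top[of "0::real"]
      proof (rule eventually_mono)
        fix t :: real assume "0 < t"
        then show "m t / t - 2 * C * T / t \<le> (p \<bullet> x - val p x t) / t"
          using divide_right_mono[OF low[of t x], of t] by (simp add: diff_divide_distrib)
      qed
      show "\<forall>\<^sub>F t in at_top. (p \<bullet> x - val p x t) / t \<le> m t / t"
        using eventually_gt_at_top[of "0::real"]
        by (rule eventually_mono) (use up in \<open>auto intro: divide_right_mono\<close>)
    qed
    from tendsto_diff[OF this zero[of "p \<bullet> x"]] show ?thesis by (simp add: diff_divide_distrib)
  qed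
  then show ?thesis by blast
qed

text \<open>An orbit that ends at a periodic translate of its start can be repeated forever, which
  bounds the value at all multiples of \<tau>.\<close>

lemma front_speed_ge:
  assumes per: "\<And>z. W (z + l) = W z" and r: "reach W \<epsilon> x (x + l) \<tau>" "0 < \<tau>"
    and lim: "((\<lambda>t. - val p x t / t) \<longlongrightarrow> r) at_top"
  shows "- (p \<bullet> l) / \<tau> \<le> r"
proof -
  have "val p x (real n * \<tau>) \<le> p \<bullet> x + real n * (p \<bullet> l)" for n
  proof (induction n)
    case 0
    then show ?case by (simp add: val_0)
  next
    case (Suc n)
    have n: "0 \<le> real n * \<tau>" using r(2) by simp
    have "val p x (\<tau> + real n * \<tau>) \<le> val p (x + l) (real n * \<tau>)" by (rule val_reach_le[OF r(1) n])
    also have "\<dots> \<le> val p x (real n * \<tau>) + p \<bullet> l" by (rule val_period_le[OF per n])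
    finally show ?case using Suc by (simp add: algebra_simps)
  qed
  note step = this
  have inf: "filterlim (\<lambda>n. real n * \<tau>) at_top sequentially"
    using r(2) filterlim_real_sequentially by (intro filterlim_at_top_mult_tendsto_pos[OF tendsto_const]) auto
  have l1: "((\<lambda>n. - val p x (real n * \<tau>) / (real n * \<tau>)) \<longlongrightarrow> r) sequentially"
    by (rule filterlim_compose[OF lim inf])
  have l2: "((\<lambda>n. - (p \<bullet> x) / (real n * \<tau>) - (p \<bullet> l) / \<tau>) \<longlongrightarrow> 0 - (p \<bullet> l) / \<tau>) sequentially"
    by (intro tendsto_intros tendsto_divide_0[OF tendsto_const] filterlim_at_top_imp_at_infinity inf)
  have "0 - (p \<bullet> l) / \<tau> \<le> r"
  proof (rule tendsto_le[OF _ l1 l2])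
    show "\<forall>\<^sub>F n in sequentially. - (p \<bullet> x) / (real n * \<tau>) - (p \<bullet> l) / \<tau> \<le> - val p x (real n * \<tau>) / (real n * \<tau>)"
      using eventually_gt_at_top[of "0::nat"]
    proof (rule eventually_mono)
      fix n :: nat assume n: "0 < n"
      have "- (p \<bullet> x) - real n * (p \<bullet> l) \<le> - val p x (real n * \<tau>)" using step[of n] by simp
      then have "(- (p \<bullet> x) - real n * (p \<bullet> l)) / (real n * \<tau>) \<le> - val p x (real n * \<tau>) / (real n * \<tau>)"
        using r(2) by (intro divide_right_mono) auto
      then show "- (p \<bullet> x) / (real n * \<tau>) - (p \<bullet> l) / \<tau> \<le> - val p x (real n * \<tau>) / (real n * \<tau>)"
        using n r(2) by (simp add: diff_divide_distrib)
    qed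
  qed simp
  then show ?thesis by simp
qed

end

section \<open>The flame speed and its limit\<close>

lemma front_value_antimono:
  assumes "drift W \<epsilon> M L" "drift W \<epsilon>' M L" "\<epsilon> \<le> \<epsilon>'" "0 \<le> t"
  shows "front_value W \<epsilon>' p x t \<le> front_value W \<epsilon> p x t"
  by (rule drift.val_greatest[OF assms(1,4)], rule drift.val_le[OF assms(2)], erule reach_mono[OF _ assms(3)])

text \<open>The description is resolved by the value function for existence and by
  \<open>viscosity_comparison\<close>, applied in both directions, for uniqueness. The factor K
  comes from evaluating the value function at time K t.\<close>

lemma turbulent_flame_speed_eq:
  fixes V :: "'a::euclidean_space \<Rightarrow> 'a"
  assumes d: "drift (\<lambda>x. - V x) (s / K) M L" and s: "0 < s" and K: "0 < K"
    and lim: "\<And>x. ((\<lambda>t. - front_value (\<lambda>x. - V x) (s / K) p x t / t) \<longlongrightarrow> r) at_top"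
  shows "turbulent_flame_speed V s p K = K * r"
proof -
  interpret drift "\<lambda>x. - V x" "s / K" M L by (rule d)
  let ?H = "G_Hamiltonian V s K"
  define G where "G = (\<lambda>(x, t). val p x (K * t))"
  have H: "?H = (\<lambda>q x. K * (s / K * norm q - (- V x) \<bullet> q))"
    using K by (auto simp: G_Hamiltonian_def fun_eq_iff algebra_simps)
  have G: "viscosity_solution_Cauchy ?H (\<lambda>x. p \<bullet> x) G"
    unfolding H G_def by (rule val_viscosity_solution[OF K])
  have limG: "((\<lambda>t. - G (x, t) / t) \<longlongrightarrow> K * r) at_top" for x
  proof -
    have "filterlim (\<lambda>t. K * t) at_top at_top"
      using K by (intro filterlim_tendsto_pos_mult_at_top[OF tendsto_const] filterlim_ident)
    then have "((\<lambda>t. - val p x (K * t) / (K * t)) \<longlongrightarrow> r) at_top" by (rule filterlim_compose[OF lim])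
    from tendsto_mult[OF tendsto_const[of K] this] show ?thesis using K by (simp add: G_def)
  qed
  have H1: "\<bar>?H q x - ?H q' x\<bar> \<le> (s + K * M) * norm (q - q')" for q q' x
  proof -
    have "\<bar>s * norm q - s * norm q'\<bar> \<le> s * norm (q - q')"
      using s norm_triangle_ineq3[of q q'] by (simp add: abs_mult flip: right_diff_distrib)
    moreover have "\<bar>V x \<bullet> (q - q')\<bar> \<le> M * norm (q - q')"
      using Cauchy_Schwarz_ineq2[of "V x" "q - q'"] mult_right_mono[OF bound[of x], of "norm (q - q')"] by simp
    then have "\<bar>K * (V x \<bullet> q) - K * (V x \<bullet> q')\<bar> \<le> K * (M * norm (q - q'))"
      using K by (simp add: abs_mult inner_diff_right flip: right_diff_distrib)
    ultimately show ?thesis by (simp add: G_Hamiltonian_def algebra_simps abs_le_iff)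
  qed
  have H2: "\<bar>?H q x - ?H q y\<bar> \<le> (K * L) * norm (x - y) * norm q" for q x y
  proof -
    have "\<bar>(V x - V y) \<bullet> q\<bar> \<le> norm (V x - V y) * norm q" by (rule Cauchy_Schwarz_ineq2)
    also have "\<dots> \<le> (L * norm (x - y)) * norm q"
      using lipschitz[of x y] by (intro mult_right_mono) (auto simp: norm_minus_commute)
    finally have "K * \<bar>(V x - V y) \<bullet> q\<bar> \<le> K * ((L * norm (x - y)) * norm q)" using K by (intro mult_left_mono) auto
    moreover have "\<bar>?H q x - ?H q y\<bar> = K * \<bar>(V x - V y) \<bullet> q\<bar>"
      using K by (simp add: G_Hamiltonian_def abs_mult inner_diff_left flip: right_diff_distrib)
    ultimately show ?thesis by (simp add: mult.assoc)
  qed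
  have A: "0 < s + K * M" "0 \<le> K * L" using s K M_nonneg L_nonneg by (auto simp: add_pos_nonneg)
  have uniq: "G' (x, t) = G (x, t)" if G': "viscosity_solution_Cauchy ?H (\<lambda>x. p \<bullet> x) G'" and t: "0 \<le> t" for G' x t
    using viscosity_comparison[OF A H1 H2 _ _ _ _ _ t, of G' G] viscosity_comparison[OF A H1 H2 _ _ _ _ _ t, of G G']
      G G' unfolding viscosity_solution_Cauchy_def by (metis dual_order.refl order_antisym)
  show ?thesis unfolding turbulent_flame_speed_def
  proof (rule the_equality)
    show "\<exists>G. viscosity_solution_Cauchy ?H (\<lambda>x. p \<bullet> x) G \<and> (\<forall>x. ((\<lambda>t. - G (x, t) / t) \<longlongrightarrow> K * r) at_top)"
      using G limG by blast
  next
    fix r' assume "\<exists>G. viscosity_solution_Cauchy ?H (\<lambda>x. p \<bullet> x) G \<and> (\<forall>x. ((\<lambda>t. - G (x, t) / t) \<longlongrightarrow> r') at_top)"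
    then obtain G' where G': "viscosity_solution_Cauchy ?H (\<lambda>x. p \<bullet> x) G'"
      "((\<lambda>t. - G' (0, t) / t) \<longlongrightarrow> r') at_top" by blast
    have "((\<lambda>t. - G (0, t) / t) \<longlongrightarrow> r') at_top"
    proof (rule Lim_transform_eventually[OF G'(2)])
      show "\<forall>\<^sub>F t in at_top. - G' (0, t) / t = - G (0, t) / t"
        using eventually_ge_at_top[of "0::real"] by (rule eventually_mono) (simp add: uniq[OF G'(1)])
    qed
    then show "r' = K * r" using limG tendsto_unique trivial_limit_at_top_linorder by blast
  qed
qed

lemma drift_ABC_minus: "0 < \<epsilon> \<Longrightarrow> drift (\<lambda>v. - ABC_flow v) \<epsilon> 6 6"
  using ABC_flow_bound ABC_flow_lipschitz by unfold_locales (auto simp: norm_minus_commute)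

lemma axis_period:
  assumes "s = 1 \<or> s = - 1" shows "(s * (2 * pi)) *\<^sub>R axis i 1 \<in> period_lattice"
  unfolding period_lattice_def mem_Collect_eq
proof
  fix j
  have "((s * (2 * pi)) *\<^sub>R axis i 1 :: real^3) $ j = 2 * pi * of_int (if i = j then if s = 1 then 1 else - 1 else 0)"
    using assms by (auto simp: axis_def)
  then show "\<exists>m::int. ((s * (2 * pi)) *\<^sub>R axis i 1 :: real^3) $ j = 2 * pi * of_int m" by blast
qed

theorem corollary1p1:
  fixes s\<^sub>l :: real and p :: "real^3"
  assumes "s\<^sub>l > 0" and "norm p = 1"
  shows "\<exists>L>0. ((\<lambda>K. turbulent_flame_speed ABC_flow s\<^sub>l p K / K) \<longlongrightarrow> L) at_top"
proof -
  let ?W = "\<lambda>v. - ABC_flow v"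
  have "\<exists>r. \<forall>x. ((\<lambda>t. - front_value ?W \<epsilon> p x t / t) \<longlongrightarrow> r) at_top" if \<epsilon>: "0 < \<epsilon>" for \<epsilon>
  proof -
    interpret drift ?W \<epsilon> 6 6 by (rule drift_ABC_minus[OF \<epsilon>])
    obtain T where "\<And>x y. \<exists>t\<le>T. \<exists>l\<in>period_lattice. reach ?W \<epsilon> x (y + l) t"
      using ABC_minus_controllable[OF \<epsilon>] by blast
    then show ?thesis by (intro front_speed_exists[where \<Lambda> = period_lattice]) (auto simp: ABC_flow_period)
  qed
  then obtain r where r: "\<And>\<epsilon> x. 0 < \<epsilon> \<Longrightarrow> ((\<lambda>t. - front_value ?W \<epsilon> p x t / t) \<longlongrightarrow> r \<epsilon>) at_top"
    by metis
  have speed: "turbulent_flame_speed ABC_flow s\<^sub>l p K = K * r (s\<^sub>l / K)" if "0 < K" for K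
    using that assms(1) by (intro turbulent_flame_speed_eq[OF drift_ABC_minus] r) auto
  have mono: "r \<epsilon> \<le> r \<epsilon>'" if "0 < \<epsilon>" "\<epsilon> \<le> \<epsilon>'" for \<epsilon> \<epsilon>'
  proof (rule tendsto_le[OF trivial_limit_at_top_linorder])
    show "((\<lambda>t. - front_value ?W \<epsilon>' p 0 t / t) \<longlongrightarrow> r \<epsilon>') at_top" using r that by simp
    show "((\<lambda>t. - front_value ?W \<epsilon> p 0 t / t) \<longlongrightarrow> r \<epsilon>) at_top" using r that by simp
    show "\<forall>\<^sub>F t in at_top. - front_value ?W \<epsilon> p 0 t / t \<le> - front_value ?W \<epsilon>' p 0 t / t"
      using eventually_gt_at_top[of "0::real"]
    proof (rule eventually_mono)
      fix t :: real assume "0 < t"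
      then show "- front_value ?W \<epsilon> p 0 t / t \<le> - front_value ?W \<epsilon>' p 0 t / t"
        using front_value_antimono[OF drift_ABC_minus drift_ABC_minus, of \<epsilon> \<epsilon>' t p 0] that by (intro divide_right_mono) auto
    qed
  qed
  obtain i where i: "p$i \<noteq> 0" using assms(2) by (metis norm_zero vec_eq_iff zero_index zero_neq_one)
  \<comment> \<open>The orbit covers 2 pi along an axis in time at most 2 pi, so its average axial
    speed is at least 1 for every \<epsilon>.\<close>
  have low: "\<bar>p$i\<bar> \<le> r \<epsilon>" if \<epsilon>: "0 < \<epsilon>" for \<epsilon>
  proof -
    interpret drift ?W \<epsilon> 6 6 by (rule drift_ABC_minus[OF \<epsilon>])
    \<comment> \<open>The rate measures the decrease of p.y, so the orbit has to run against the
      sign of \<open>p$i\<close>.\<close>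
    define s where "s = (if 0 < p$i then - 1 else 1 :: real)"
    have s: "s = 1 \<or> s = - 1" "s * p$i = - \<bar>p$i\<bar>" by (auto simp: s_def)
    let ?l = "(s * (2 * pi)) *\<^sub>R axis i 1 :: real^3"
    obtain x \<tau> where \<tau>: "\<tau> \<le> 2 * pi" "reach ?W \<epsilon> x (x + ?l) \<tau>" using ballistic_axis_minus[OF \<epsilon> s(1)] by blast
    have "norm ?l = 2 * pi" using s(1) by (auto simp: norm_axis_1)
    \<comment> \<open>The displacement 2 pi at speed at most 6 + \<epsilon> forces a positive
      duration.\<close>
    then have "2 * pi \<le> (6 + \<epsilon>) * \<tau>" using reach_dist[OF \<tau>(2)] by simp
    then have "0 < (6 + \<epsilon>) * \<tau>" using pi_gt_zero by linarith
    then have \<tau>0: "0 < \<tau>" using \<epsilon> by (simp add: zero_less_mult_iff)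
    have "p \<bullet> ?l = 2 * pi * (s * p$i)" by (simp add: inner_axis)
    also have "\<dots> = - (2 * pi * \<bar>p$i\<bar>)" unfolding s(2) by simp
    finally have eq: "- (p \<bullet> ?l) = 2 * pi * \<bar>p$i\<bar>" by linarith
    have "\<bar>p$i\<bar> * \<tau> \<le> \<bar>p$i\<bar> * (2 * pi)" by (rule mult_left_mono[OF \<tau>(1)]) simp
    then have "\<bar>p$i\<bar> \<le> 2 * pi * \<bar>p$i\<bar> / \<tau>" by (simp only: pos_le_divide_eq[OF \<tau>0] mult.commute)
    also have "\<dots> = - (p \<bullet> ?l) / \<tau>" unfolding eq ..
    also have "\<dots> \<le> r \<epsilon>"
      by (rule front_speed_ge[OF _ \<tau>(2) \<tau>0 r[OF \<epsilon>]]) (simp add: ABC_flow_period axis_period[OF s(1)])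
    finally show ?thesis .
  qed
  \<comment> \<open>As K grows, \<open>s\<^sub>l / K\<close> decreases to 0; by monotonicity of
    \<open>r\<close> the limit is this infimum, and the uniform lower bound passes to it.\<close>
  define L where "L = (INF \<epsilon>\<in>{0<..}. r \<epsilon>)"
  have bdd: "bdd_below (r ` {0<..})" using low by (intro bdd_belowI2[of _ "\<bar>p$i\<bar>"]) auto
  have "\<bar>p$i\<bar> \<le> L" unfolding L_def by (rule cINF_greatest) (auto simp: low)
  then have "0 < L" using i by simp
  moreover have "((\<lambda>K. turbulent_flame_speed ABC_flow s\<^sub>l p K / K) \<longlongrightarrow> L) at_top"
  proof (rule Lim_transform_eventually)
    show "\<forall>\<^sub>F K in at_top. r (s\<^sub>l / K) = turbulent_flame_speed ABC_flow s\<^sub>l p K / K"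
      using eventually_gt_at_top[of "0::real"] by (rule eventually_mono) (simp add: speed)
    show "((\<lambda>K. r (s\<^sub>l / K)) \<longlongrightarrow> L) at_top"
    proof (rule order_tendstoI)
      fix a assume a: "a < L"
      show "\<forall>\<^sub>F K in at_top. a < r (s\<^sub>l / K)"
        using eventually_gt_at_top[of "0::real"]
      proof (rule eventually_mono)
        fix K :: real assume "0 < K"
        then have "L \<le> r (s\<^sub>l / K)" unfolding L_def using assms(1) by (intro cINF_lower[OF bdd]) auto
        then show "a < r (s\<^sub>l / K)" using a by simp
      qed
    next
      fix a assume "L < a"
      then have "\<exists>\<epsilon>\<in>{0<..}. r \<epsilon> < a" unfolding L_def by (subst (asm) cINF_less_iff[OF _ bdd]) auto
      then obtain \<epsilon> where \<epsilon>: "0 < \<epsilon>" "r \<epsilon> < a" by blast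
      show "\<forall>\<^sub>F K in at_top. r (s\<^sub>l / K) < a"
        using eventually_gt_at_top[of "s\<^sub>l / \<epsilon>"]
      proof (rule eventually_mono)
        fix K assume K: "s\<^sub>l / \<epsilon> < K"
        have "0 < s\<^sub>l / \<epsilon>" using assms(1) \<epsilon> by simp
        then have "0 < K" using K by simp
        then have "0 < s\<^sub>l / K" "s\<^sub>l / K \<le> \<epsilon>" using K \<epsilon> assms(1) by (auto simp: field_simps)
        then show "r (s\<^sub>l / K) < a" using mono[of "s\<^sub>l / K" \<epsilon>] \<epsilon>(2) by simp
      qed
    qed
  qed
  ultimately show ?thesis by blast
qed

end
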